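(* Let $R$ be a strongly $t$-discrete domain. Then $R$ is a pseudo-integrally closed Clifford $t$-regular domain if and only if $R$ is a Krull-type domain.
   Context: All rings are integral domains. Let $R$ be a domain with quotient field $K$. For fractional ideals $I,J$ of $R$, $(I:J)=\{x\in K : xJ\subseteq I\}$. For a nonzero fractional ideal $I$, put $I^{-1}=(R:I)$, $I_v=(I^{-1})^{-1}$, and $I_t=\bigcup J_v$, where $J$ ranges over the nonzero finitely generated fractional ideals contained in $I$. $I$ is a $t$-ideal if it is nonzero and $I_t=I$. A $t$-prime ideal is a prime ideal that is a $t$-ideal; a $t$-maximal ideal is a maximal element of the set of proper integral $t$-ideals of $R$. The fractional $t$-ideals form a commutative semigroup $F_t(R)$ under $(I,J)\mapsto (IJ)_t$, and $\mathcal S_t(R)=F_t(R)/P(R)$ is the quotient by the group $P(R)$ of nonzero principal fractional ideals (so the classes of $I$ and $J$ coincide iff $I=cJ$ for some $0\neq c\in K$). A commutative semigroup $S$ is Clifford if for every $x\in S$ there is $a\in S$ with $x^2a=x$. $R$ is Clifford $t$-regular if $\mathcal S_t(R)$ is Clifford. $R$ is strongly $t$-discrete if $(P^2)_t\subsetneq P$ for every $t$-prime ideal $P$ of $R$. $R$ is pseudo-integrally closed if $R=\widetilde R$, where $\widetilde R=\bigcup (I_t:I_t)$ with $I$ ranging over the nonzero finitely generated ideals of $R$. $R$ is a PVMD if $R_M$ is a valuation domain for each $t$-maximal ideal $M$ of $R$. A Krull-type domain is a PVMD of finite $t$-character, i.e., a PVMD in which each nonzero nonunit is contained in only finitely many $t$-maximal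 ideals. *)

theory Defs
  imports Complex_Main
begin

text \<open>
  A domain \<open>R\<close> with quotient field \<open>K\<close> is a subring \<open>R\<close> of a field type \<open>'k\<close> (playing the role
  of \<open>K\<close>) such that every element of \<open>'k\<close> is a quotient of elements of \<open>R\<close>. Ideals, fractional
  ideals and overrings of \<open>R\<close> are then all subsets of \<open>'k\<close>.
\<close>

definition is_subring :: "'k::field set \<Rightarrow> bool" where
  "is_subring R \<longleftrightarrow> 0 \<in> R \<and> 1 \<in> R \<and>
     (\<forall>x\<in>R. \<forall>y\<in>R. x - y \<in> R \<and> x * y \<in> R)"

definition domain_with_quotient_field :: "'k::field set \<Rightarrow> bool" where
  "domain_with_quotient_field R \<longleftrightarrow> is_subring R \<and>
     (\<forall>x. \<exists>a\<in>R. \<exists>b\<in>R. b \<noteq> 0 \<and> x = a / b)"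

definition submodule :: "'k::field set \<Rightarrow> 'k set \<Rightarrow> bool" where
  "submodule R I \<longleftrightarrow> 0 \<in> I \<and> (\<forall>x\<in>I. \<forall>y\<in>I. x + y \<in> I) \<and> (\<forall>r\<in>R. \<forall>x\<in>I. r * x \<in> I)"

definition fractional_ideal :: "'k::field set \<Rightarrow> 'k set \<Rightarrow> bool" where
  "fractional_ideal R I \<longleftrightarrow> submodule R I \<and> (\<exists>d\<in>R. d \<noteq> 0 \<and> (\<forall>x\<in>I. d * x \<in> R))"

definition integral_ideal :: "'k::field set \<Rightarrow> 'k set \<Rightarrow> bool" where
  "integral_ideal R I \<longleftrightarrow> submodule R I \<and> I \<subseteq> R"

definition finitely_generated :: "'k::field set \<Rightarrow> 'k set \<Rightarrow> bool" where
  "finitely_generated R I \<longleftrightarrow> (\<exists>F. finite F \<and> I = submodule R hull F)"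

definition ideal_mult :: "'k::field set \<Rightarrow> 'k set \<Rightarrow> 'k set \<Rightarrow> 'k set" where
  "ideal_mult R I J = submodule R hull {x * y | x y. x \<in> I \<and> y \<in> J}"

definition colon :: "'k::field set \<Rightarrow> 'k set \<Rightarrow> 'k set" where
  "colon I J = {x. \<forall>y\<in>J. x * y \<in> I}"

definition ideal_inverse :: "'k::field set \<Rightarrow> 'k set \<Rightarrow> 'k set" where
  "ideal_inverse R I = colon R I"

definition v_closure :: "'k::field set \<Rightarrow> 'k set \<Rightarrow> 'k set" where
  "v_closure R I = ideal_inverse R (ideal_inverse R I)"

definition t_closure :: "'k::field set \<Rightarrow> 'k set \<Rightarrow> 'k set" where
  "t_closure R I =
     \<Union> {v_closure R J | J. fractional_ideal R J \<and> J \<noteq> {0} \<and> finitely_generated R J \<and> J \<subseteq> I}"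

definition fractional_t_ideals :: "'k::field set \<Rightarrow> 'k set set" where
  "fractional_t_ideals R = {I. fractional_ideal R I \<and> I \<noteq> {0} \<and> t_closure R I = I}"

definition prime_ideal :: "'k::field set \<Rightarrow> 'k set \<Rightarrow> bool" where
  "prime_ideal R P \<longleftrightarrow> integral_ideal R P \<and> P \<noteq> R \<and>
     (\<forall>x\<in>R. \<forall>y\<in>R. x * y \<in> P \<longrightarrow> x \<in> P \<or> y \<in> P)"

definition t_prime_ideal :: "'k::field set \<Rightarrow> 'k set \<Rightarrow> bool" where
  "t_prime_ideal R P \<longleftrightarrow> prime_ideal R P \<and> P \<in> fractional_t_ideals R"

definition proper_integral_t_ideals :: "'k::field set \<Rightarrow> 'k set set" where
  "proper_integral_t_ideals R = {I \<in> fractional_t_ideals R. integral_ideal R I \<and> I \<noteq> R}"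

definition t_maximal_ideal :: "'k::field set \<Rightarrow> 'k set \<Rightarrow> bool" where
  "t_maximal_ideal R M \<longleftrightarrow> M \<in> proper_integral_t_ideals R \<and>
     (\<forall>I\<in>proper_integral_t_ideals R. M \<subseteq> I \<longrightarrow> I = M)"

definition t_mult :: "'k::field set \<Rightarrow> 'k set \<Rightarrow> 'k set \<Rightarrow> 'k set" where
  "t_mult R I J = t_closure R (ideal_mult R I J)"

definition principal_equiv :: "'k::field set \<Rightarrow> ('k set \<times> 'k set) set" where
  "principal_equiv R =
     {(I, J). I \<in> fractional_t_ideals R \<and> J \<in> fractional_t_ideals R \<and>
              (\<exists>c. c \<noteq> 0 \<and> I = (\<lambda>x. c * x) ` J)}"

definition t_class_semigroup :: "'k::field set \<Rightarrow> 'k set set set" where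
  "t_class_semigroup R = fractional_t_ideals R // principal_equiv R"

text \<open>The product of two classes is the class of \<open>t_mult R I J\<close> for any representatives \<open>I\<close>, \<open>J\<close>.\<close>

definition t_class_mult :: "'k::field set \<Rightarrow> 'k set set \<Rightarrow> 'k set set \<Rightarrow> 'k set set" where
  "t_class_mult R X Y = (\<Union>I\<in>X. \<Union>J\<in>Y. principal_equiv R `` {t_mult R I J})"

definition comm_semigroup_on :: "'s set \<Rightarrow> ('s \<Rightarrow> 's \<Rightarrow> 's) \<Rightarrow> bool" where
  "comm_semigroup_on S m \<longleftrightarrow>
     (\<forall>x\<in>S. \<forall>y\<in>S. m x y \<in> S \<and> m x y = m y x) \<and>
     (\<forall>x\<in>S. \<forall>y\<in>S. \<forall>z\<in>S. m (m x y) z = m x (m y z))"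

definition clifford_semigroup :: "'s set \<Rightarrow> ('s \<Rightarrow> 's \<Rightarrow> 's) \<Rightarrow> bool" where
  "clifford_semigroup S m \<longleftrightarrow> comm_semigroup_on S m \<and> (\<forall>x\<in>S. \<exists>a\<in>S. m (m x x) a = x)"

definition clifford_t_regular :: "'k::field set \<Rightarrow> bool" where
  "clifford_t_regular R \<longleftrightarrow> clifford_semigroup (t_class_semigroup R) (t_class_mult R)"

definition strongly_t_discrete :: "'k::field set \<Rightarrow> bool" where
  "strongly_t_discrete R \<longleftrightarrow>
     (\<forall>P. t_prime_ideal R P \<longrightarrow> t_closure R (ideal_mult R P P) \<subset> P)"

definition pseudo_integral_closure :: "'k::field set \<Rightarrow> 'k set" where
  "pseudo_integral_closure R =
     \<Union> {colon (t_closure R I) (t_closure R I) | I.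
           integral_ideal R I \<and> I \<noteq> {0} \<and> finitely_generated R I}"

definition pseudo_integrally_closed :: "'k::field set \<Rightarrow> bool" where
  "pseudo_integrally_closed R \<longleftrightarrow> R = pseudo_integral_closure R"

definition localization_at :: "'k::field set \<Rightarrow> 'k set \<Rightarrow> 'k set" where
  "localization_at R P = {a / s | a s. a \<in> R \<and> s \<in> R - P}"

text \<open>
  The second condition says that \<open>V\<close> is a valuation domain whose quotient field is the whole of
  \<open>'k\<close>; this is no restriction for localizations of \<open>R\<close>, which all have quotient field \<open>'k\<close>.
\<close>

definition valuation_domain :: "'k::field set \<Rightarrow> bool" where
  "valuation_domain V \<longleftrightarrow> is_subring V \<and> (\<forall>x. x \<noteq> 0 \<longrightarrow> x \<in> V \<or> inverse x \<in> V)"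

definition PVMD :: "'k::field set \<Rightarrow> bool" where
  "PVMD R \<longleftrightarrow> (\<forall>M. t_maximal_ideal R M \<longrightarrow> valuation_domain (localization_at R M))"

definition finite_t_character :: "'k::field set \<Rightarrow> bool" where
  "finite_t_character R \<longleftrightarrow>
     (\<forall>x\<in>R. x \<noteq> 0 \<and> \<not> (\<exists>y\<in>R. x * y = 1) \<longrightarrow> finite {M. t_maximal_ideal R M \<and> x \<in> M})"

definition krull_type_domain :: "'k::field set \<Rightarrow> bool" where
  "krull_type_domain R \<longleftrightarrow> PVMD R \<and> finite_t_character R"

end

theory Submission
  imports Defs
begin

text \<open>
  Both directions rest on a local description of the t-operation. An element \<open>x\<close> of \<open>K\<close> that lies
  in \<open>I R\<^sub>M\<close> for every maximal t-ideal \<open>M\<close> lies in \<open>I\<^sub>t\<close>, because the ideal of all \<open>r\<close> with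
  \<open>r x \<in> I\<close> is contained in no \<open>M\<close> (\<open>mem_t_closureI_local\<close>). Conversely, if \<open>R\<^sub>M\<close> is a valuation
  ring, then \<open>I\<^sub>t \<subseteq> I R\<^sub>M\<close>, because a finite set generates a principal ideal of \<open>R\<^sub>M\<close>
  (\<open>t_closure_subset_localize\<close>). So in a PVMD equations between t-ideals can be checked locally.
  The Clifford property says that every fractional t-ideal \<open>I\<close> has a fractional t-ideal \<open>J\<close> with
  \<open>(I\<^sup>2 J)\<^sub>t = I\<close> (\<open>clifford_t_regular_iff\<close>).

  Let \<open>R\<close> be of Krull type, and let \<open>I \<subseteq> R\<close> be a t-ideal. In a strongly discrete valuation ring every
  nonzero ideal is generated by one element over its ring of multipliers, which is a localization.
  Strong t-discreteness transports this to \<open>R\<^sub>M\<close>: there is \<open>a \<in> I\<close> with \<open>I\<^sup>2 R\<^sub>M \<subseteq> a I R\<^sub>M\<close>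
  (\<open>square_locally_in_multiple\<close>). Choose such an element for each of the finitely many \<open>M\<close> that contain
  a fixed nonzero element of \<open>I\<close>, and let \<open>A\<close> consist of these elements and the fixed one. Then
  \<open>J = A\<^sup>-\<^sup>1\<close> satisfies \<open>(I\<^sup>2 J)\<^sub>t = I\<close>, as one sees locally (\<open>integral_t_ideal_regular\<close>).

  Let \<open>R\<close> be pseudo-integrally closed and Clifford t-regular. For a nonzero finitely generated ideal \<open>I\<close>
  one has \<open>(I\<^sub>t : I\<^sub>t) = R\<close>, so the \<open>J\<close> that belongs to \<open>I\<^sub>t\<close> satisfies \<open>I J \<subseteq> R\<close>, and cancelling
  \<open>I\<close> shows that \<open>I J\<close> lies in no maximal t-ideal. For \<open>I = (a, b)\<close> this makes \<open>a / b\<close> or \<open>b / a\<close> an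
  element of \<open>R\<^sub>M\<close> (\<open>clifford_imp_PVMD\<close>). By a similar cancellation, every locally principal \<open>I\<close> is
  t-invertible (\<open>locally_principal_imp_t_invertible\<close>). By strong t-discreteness each maximal t-ideal
  \<open>M\<close> is locally principal, hence t-invertible. Given \<open>x \<noteq> 0\<close>, the ideal \<open>I\<close> generated by \<open>x\<close> and all
  \<open>x M\<^sup>-\<^sup>1\<close> with \<open>x \<in> M\<close> is again locally principal, and so it is t-invertible; hence it behaves like a
  finitely generated ideal and involves only finitely many of the \<open>M\<^sup>-\<^sup>1\<close>. As \<open>I R\<^sub>M \<noteq> x R\<^sub>M\<close> for every
  \<open>M\<close> containing \<open>x\<close>, there are only finitely many such \<open>M\<close> (\<open>clifford_imp_finite_t_character\<close>).
\<close>

section \<open>Submodules of the quotient field\<close>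

text \<open>
  The localization \<open>I R\<^sub>P\<close> inside the quotient field, described by denominators that clear an element
  into \<open>I\<close>; for \<open>I = R\<close> and \<open>P\<close> prime it is \<^const>\<open>localization_at\<close>.
\<close>
definition localize :: "'k::field set \<Rightarrow> 'k set \<Rightarrow> 'k set \<Rightarrow> 'k set" where
  "localize R P I = {x. \<exists>s\<in>R - P. s * x \<in> I}"

locale domain_in_field =
  fixes R :: "'k::field set"
  assumes quotient_field: "domain_with_quotient_field R"
begin

lemma subring: "is_subring R"
  using quotient_field by (simp add: domain_with_quotient_field_def)

lemma R_zero [simp]: "0 \<in> R" and R_one [simp]: "1 \<in> R"
  using subring by (auto simp: is_subring_def)

lemma R_diff: "x \<in> R \<Longrightarrow> y \<in> R \<Longrightarrow> x - y \<in> R"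
  and R_mult: "x \<in> R \<Longrightarrow> y \<in> R \<Longrightarrow> x * y \<in> R"
  using subring by (auto simp: is_subring_def)

lemma R_add: "x \<in> R \<Longrightarrow> y \<in> R \<Longrightarrow> x + y \<in> R"
  using R_diff[of x "0 - y"] R_diff[of 0 y] by simp

lemma quotient: obtains a b where "a \<in> R" "b \<in> R" "b \<noteq> 0" "x = a / b"
  using quotient_field unfolding domain_with_quotient_field_def by blast

lemma submoduleD:
  assumes "submodule R I"
  shows "0 \<in> I" "x \<in> I \<Longrightarrow> y \<in> I \<Longrightarrow> x + y \<in> I" "r \<in> R \<Longrightarrow> x \<in> I \<Longrightarrow> r * x \<in> I"
    "r \<in> R \<Longrightarrow> x \<in> I \<Longrightarrow> x * r \<in> I"
  using assms by (auto simp: submodule_def mult.commute)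

lemma submodule_R: "submodule R R"
  by (auto simp: submodule_def R_add R_mult)

lemma submodule_hull: "submodule R (submodule R hull S)"
  by (rule hull_in) (auto simp: submodule_def)

lemma submodule_colon_preimage:
  assumes "submodule R I" shows "submodule R {x. c * x \<in> I}"
proof -
  have "c * (r * x) \<in> I" if "r \<in> R" "c * x \<in> I" for r x
    using submoduleD(3)[OF assms that] by (simp add: mult.left_commute)
  thus ?thesis using submoduleD[OF assms] by (auto simp: submodule_def distrib_left)
qed

lemma submodule_ideal_mult: "submodule R (ideal_mult R I J)"
  by (simp add: ideal_mult_def submodule_hull)

lemma ideal_mult_memI: "x \<in> I \<Longrightarrow> y \<in> J \<Longrightarrow> x * y \<in> ideal_mult R I J"
  unfolding ideal_mult_def by (rule hull_inc) blast

lemma ideal_mult_minimal: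
  assumes "submodule R L" "\<And>x y. x \<in> I \<Longrightarrow> y \<in> J \<Longrightarrow> x * y \<in> L"
  shows "ideal_mult R I J \<subseteq> L"
  unfolding ideal_mult_def using assms by (intro hull_minimal) auto

lemma common_denominator:
  assumes "finite F"
  obtains d where "d \<in> R" "d \<noteq> 0" "\<And>x. x \<in> F \<Longrightarrow> d * x \<in> R"
proof -
  have "\<exists>d\<in>R. d \<noteq> 0 \<and> (\<forall>x\<in>F. d * x \<in> R)"
    using assms
  proof induction
    case empty
    show ?case by (intro bexI[of _ 1]) auto
  next
    case (insert y F)
    then obtain d where d: "d \<in> R" "d \<noteq> 0" "\<forall>x\<in>F. d * x \<in> R" by blast
    obtain a b where ab: "a \<in> R" "b \<in> R" "b \<noteq> 0" "y = a / b" by (rule quotient)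
    have "(b * d) * y = d * a" using ab by simp
    moreover have "(b * d) * x = b * (d * x)" for x by simp
    ultimately have "\<forall>x\<in>insert y F. (b * d) * x \<in> R" using d ab R_mult by (metis insert_iff)
    moreover have "b * d \<in> R" "b * d \<noteq> 0" using d ab R_mult by auto
    ultimately show ?case by blast
  qed
  thus ?thesis using that by blast
qed

lemma fractional_hull: "finite F \<Longrightarrow> fractional_ideal R (submodule R hull F)"
proof -
  assume "finite F"
  then obtain d where d: "d \<in> R" "d \<noteq> 0" "\<And>x. x \<in> F \<Longrightarrow> d * x \<in> R"
    by (rule common_denominator) blast
  have "submodule R hull F \<subseteq> {x. d * x \<in> R}"
    using d by (intro hull_minimal submodule_colon_preimage submodule_R) auto
  thus ?thesis using d submodule_hull by (auto simp: fractional_ideal_def)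
qed

section \<open>The v- and the t-operation on submodules\<close>

lemma v_closure_iff:
  "x \<in> v_closure R F \<longleftrightarrow> (\<forall>y. (\<forall>f\<in>F. y * f \<in> R) \<longrightarrow> x * y \<in> R)"
  by (auto simp: v_closure_def ideal_inverse_def colon_def)

lemma v_closure_incl: "F \<subseteq> v_closure R F"
  unfolding v_closure_iff subset_iff by (metis mult.commute)

lemma v_closure_mono: "F \<subseteq> G \<Longrightarrow> v_closure R F \<subseteq> v_closure R G"
  unfolding v_closure_iff subset_iff by blast

lemma v_closure_mult:
  assumes "\<And>f. f \<in> F \<Longrightarrow> c * f \<in> v_closure R G" and "x \<in> v_closure R F"
  shows "c * x \<in> v_closure R G"
  unfolding v_closure_iff
proof (intro allI impI)
  fix y assume y: "\<forall>g\<in>G. y * g \<in> R"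
  have "(c * y) * f \<in> R" if "f \<in> F" for f
    using assms(1)[OF that, unfolded v_closure_iff, rule_format, of y] y by (simp add: mult_ac)
  thus "c * x * y \<in> R"
    using assms(2)[unfolded v_closure_iff, rule_format, of "c * y"] by (simp add: mult_ac)
qed

lemma submodule_v_closure: "submodule R (v_closure R F)"
  by (auto simp: submodule_def v_closure_iff distrib_right mult.assoc intro: R_add R_mult)

lemma v_closure_hull: "v_closure R (submodule R hull F) = v_closure R F"
proof
  show "v_closure R (submodule R hull F) \<subseteq> v_closure R F"
  proof
    fix x assume "x \<in> v_closure R (submodule R hull F)"
    moreover have "submodule R hull F \<subseteq> v_closure R F"
      by (intro hull_minimal v_closure_incl submodule_v_closure)
    ultimately show "x \<in> v_closure R F"
      using v_closure_mult[of "submodule R hull F" 1 F x] by auto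
  qed
qed (intro v_closure_mono hull_subset)

text \<open>A finitely generated ideal and its generating set have the same inverse. Finite subsets of \<open>I\<close>
  can therefore replace the finitely generated ideals in the definition; the one ideal excluded
  there, \<open>{0}\<close>, is the one generated by a subset of \<open>{0}\<close>.\<close>
lemma t_closure_iff:
  assumes "submodule R I"
  shows "x \<in> t_closure R I \<longleftrightarrow> (\<exists>F. finite F \<and> F \<subseteq> I \<and> \<not> F \<subseteq> {0} \<and> x \<in> v_closure R F)"
proof
  assume "x \<in> t_closure R I"
  then obtain F where F: "finite F" "submodule R hull F \<subseteq> I" "submodule R hull F \<noteq> {0}"
      "x \<in> v_closure R (submodule R hull F)"
    unfolding t_closure_def finitely_generated_def by blast
  have "F \<subseteq> I" using F(2) hull_subset by fastforce
  moreover have "\<not> F \<subseteq> {0}"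
  proof
    assume "F \<subseteq> {0}"
    hence "submodule R hull F \<subseteq> {0}" by (intro hull_minimal) (auto simp: submodule_def)
    thus False using F(3) submoduleD(1)[OF submodule_hull[of F]] by auto
  qed
  ultimately show "\<exists>F. finite F \<and> F \<subseteq> I \<and> \<not> F \<subseteq> {0} \<and> x \<in> v_closure R F"
    using F by (auto simp: v_closure_hull)
next
  assume "\<exists>F. finite F \<and> F \<subseteq> I \<and> \<not> F \<subseteq> {0} \<and> x \<in> v_closure R F"
  then obtain F where F: "finite F" "F \<subseteq> I" "\<not> F \<subseteq> {0}" "x \<in> v_closure R F" by blast
  have 1: "submodule R hull F \<subseteq> I" by (intro hull_minimal F assms)
  have 2: "submodule R hull F \<noteq> {0}" using F(3) hull_subset[of F "submodule R"] by auto
  have 3: "finitely_generated R (submodule R hull F)"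
    using F(1) unfolding finitely_generated_def by blast
  show "x \<in> t_closure R I"
    using F(4) 1 2 3 fractional_hull[OF F(1)] v_closure_hull[of F] unfolding t_closure_def by blast
qed

lemma t_closureI:
  assumes "submodule R I" "finite F" "F \<subseteq> I" "\<not> F \<subseteq> {0}" "x \<in> v_closure R F"
  shows "x \<in> t_closure R I"
  using assms(2-5) unfolding t_closure_iff[OF assms(1)] by blast

lemma t_closure_incl:
  assumes "submodule R I" "I \<noteq> {0}"
  shows "I \<subseteq> t_closure R I"
proof
  fix x assume x: "x \<in> I"
  obtain z where "z \<in> I" "z \<noteq> 0" using assms submoduleD(1)[OF assms(1)] by blast
  hence "finite {x, z}" "{x, z} \<subseteq> I" "\<not> {x, z} \<subseteq> {0}" "x \<in> v_closure R {x, z}"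
    using x v_closure_incl[of "{x, z}"] by auto
  thus "x \<in> t_closure R I" unfolding t_closure_iff[OF assms(1)] by blast
qed

lemma t_closure_mono: "I \<subseteq> J \<Longrightarrow> t_closure R I \<subseteq> t_closure R J"
  unfolding t_closure_def by blast

text \<open>The t-closure is the directed union of the v-closures of finite subsets, so finitely many of its
  elements lie in a single one of them.\<close>
lemma t_closure_finite:
  assumes I: "submodule R I" "I \<noteq> {0}" and F: "finite F" "F \<subseteq> t_closure R I"
  obtains G where "finite G" "G \<subseteq> I" "\<not> G \<subseteq> {0}" "F \<subseteq> v_closure R G"
proof -
  have "\<exists>G. finite G \<and> G \<subseteq> I \<and> \<not> G \<subseteq> {0} \<and> F \<subseteq> v_closure R G"
    using F
  proof (induction F)
    case empty
    obtain z where "z \<in> I" "z \<noteq> 0" using I submoduleD(1)[OF I(1)] by blast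
    thus ?case by (intro exI[of _ "{z}"]) auto
  next
    case (insert x F)
    then obtain G where G: "finite G" "G \<subseteq> I" "\<not> G \<subseteq> {0}" "F \<subseteq> v_closure R G" by auto
    obtain H where H: "finite H" "H \<subseteq> I" "x \<in> v_closure R H"
      using insert.prems t_closure_iff[OF I(1)] by auto
    have "insert x F \<subseteq> v_closure R (G \<union> H)"
      using G(4) H(3) v_closure_mono[of G "G \<union> H"] v_closure_mono[of H "G \<union> H"] by auto
    thus ?case using G H by (intro exI[of _ "G \<union> H"]) auto
  qed
  thus ?thesis using that by blast
qed

lemma submodule_t_closure:
  assumes "submodule R I" "I \<noteq> {0}"
  shows "submodule R (t_closure R I)"
  unfolding submodule_def
proof (intro conjI ballI)
  show "0 \<in> t_closure R I" using t_closure_incl[OF assms] submoduleD(1)[OF assms(1)] by blast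
next
  fix x y assume "x \<in> t_closure R I" "y \<in> t_closure R I"
  hence "finite {x, y}" "{x, y} \<subseteq> t_closure R I" by auto
  from t_closure_finite[OF assms this] obtain G
    where "finite G" "G \<subseteq> I" "\<not> G \<subseteq> {0}" "{x, y} \<subseteq> v_closure R G" .
  thus "x + y \<in> t_closure R I" unfolding t_closure_iff[OF assms(1)]
    using submoduleD(2)[OF submodule_v_closure, of x G y] by blast
next
  fix r x assume "r \<in> R" "x \<in> t_closure R I"
  thus "r * x \<in> t_closure R I" unfolding t_closure_iff[OF assms(1)]
    using submoduleD(3)[OF submodule_v_closure] by blast
qed

text \<open>All facts about t-products follow from this rule, applied to one factor at a time.\<close>
lemma t_closure_mult:
  assumes "submodule R I" "submodule R J" "J \<noteq> {0}"
    and cI: "\<And>x. x \<in> I \<Longrightarrow> c * x \<in> t_closure R J" and x: "x \<in> t_closure R I"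
  shows "c * x \<in> t_closure R J"
proof -
  obtain F where F: "finite F" "F \<subseteq> I" "x \<in> v_closure R F"
    using x t_closure_iff[OF assms(1)] by blast
  have "finite ((*) c ` F)" "(*) c ` F \<subseteq> t_closure R J" using F cI by auto
  from t_closure_finite[OF assms(2,3) this] obtain G where
    G: "finite G" "G \<subseteq> J" "\<not> G \<subseteq> {0}" "(*) c ` F \<subseteq> v_closure R G" .
  have "c * x \<in> v_closure R G" by (rule v_closure_mult[OF _ F(3)]) (use G in auto)
  thus ?thesis using G t_closure_iff[OF assms(2)] by blast
qed

lemma t_closure_t_closure:
  assumes "submodule R I" "I \<noteq> {0}"
  shows "t_closure R (t_closure R I) = t_closure R I"
proof
  have ne: "submodule R (t_closure R I)" by (rule submodule_t_closure[OF assms])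
  show "t_closure R (t_closure R I) \<subseteq> t_closure R I"
    using t_closure_mult[OF ne assms, of 1] by auto
qed (intro t_closure_mono t_closure_incl[OF assms])

lemma t_closure_in_R:
  assumes "submodule R I" "\<And>x. x \<in> I \<Longrightarrow> d * x \<in> R" "x \<in> t_closure R I"
  shows "d * x \<in> R"
proof -
  obtain F where F: "F \<subseteq> I" "x \<in> v_closure R F"
    using assms(3) t_closure_iff[OF assms(1)] by blast
  thus ?thesis using assms(2) by (force simp: v_closure_iff mult.commute)
qed

section \<open>Fractional t-ideals and their semigroup\<close>

lemma t_idealD:
  assumes "I \<in> fractional_t_ideals R"
  shows "submodule R I" "I \<noteq> {0}" "t_closure R I = I" "\<exists>d\<in>R. d \<noteq> 0 \<and> (\<forall>x\<in>I. d * x \<in> R)"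
  using assms by (auto simp: fractional_t_ideals_def fractional_ideal_def)

lemma nonzero_element:
  assumes "submodule R I" "I \<noteq> {0}" obtains z where "z \<in> I" "z \<noteq> 0"
  using assms submoduleD(1)[OF assms(1)] by blast

lemma t_closure_t_ideal:
  assumes "submodule R I" "I \<noteq> {0}" "d \<in> R" "d \<noteq> 0" "\<And>x. x \<in> I \<Longrightarrow> d * x \<in> R"
  shows "t_closure R I \<in> fractional_t_ideals R"
proof -
  have "t_closure R I \<noteq> {0}"
    using nonzero_element[OF assms(1,2)] t_closure_incl[OF assms(1,2)] by (metis singletonD subsetD)
  thus ?thesis using assms t_closure_t_closure submodule_t_closure t_closure_in_R[OF assms(1)]
    by (auto simp: fractional_t_ideals_def fractional_ideal_def)
qed

lemma t_ideal_mult_closed: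
  assumes L: "L \<in> fractional_t_ideals R" and I: "submodule R I"
    and "\<And>x. x \<in> I \<Longrightarrow> c * x \<in> L" "x \<in> t_closure R I"
  shows "c * x \<in> L"
  using t_closure_mult[OF I t_idealD(1,2)[OF L], of c x] assms by (simp add: t_idealD(3)[OF L])

lemma ideal_mult_fractional:
  assumes I: "I \<in> fractional_t_ideals R" and J: "J \<in> fractional_t_ideals R"
  shows "ideal_mult R I J \<noteq> {0}" "\<exists>d\<in>R. d \<noteq> 0 \<and> (\<forall>x\<in>ideal_mult R I J. d * x \<in> R)"
proof -
  obtain x where x: "x \<in> I" "x \<noteq> 0" by (rule nonzero_element[OF t_idealD(1,2)[OF I]])
  obtain y where y: "y \<in> J" "y \<noteq> 0" by (rule nonzero_element[OF t_idealD(1,2)[OF J]])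
  show "ideal_mult R I J \<noteq> {0}" using ideal_mult_memI[OF x(1) y(1)] x(2) y(2) by (metis mult_eq_0_iff singletonD)
  obtain d where d: "d \<in> R" "d \<noteq> 0" "\<forall>x\<in>I. d * x \<in> R" using t_idealD(4)[OF I] by blast
  obtain e where e: "e \<in> R" "e \<noteq> 0" "\<forall>x\<in>J. e * x \<in> R" using t_idealD(4)[OF J] by blast
  have "(d * e) * (x * y) \<in> R" if "x \<in> I" "y \<in> J" for x y
    using R_mult[of "d * x" "e * y"] d e that by (simp add: mult_ac)
  hence "ideal_mult R I J \<subseteq> {x. (d * e) * x \<in> R}"
    by (intro ideal_mult_minimal submodule_colon_preimage submodule_R) blast
  moreover have "d * e \<in> R" "d * e \<noteq> 0" using d e R_mult by auto
  ultimately show "\<exists>d\<in>R. d \<noteq> 0 \<and> (\<forall>x\<in>ideal_mult R I J. d * x \<in> R)" by blast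
qed

lemma t_mult_t_ideal:
  assumes "I \<in> fractional_t_ideals R" "J \<in> fractional_t_ideals R"
  shows "t_mult R I J \<in> fractional_t_ideals R"
  using ideal_mult_fractional[OF assms] t_closure_t_ideal[OF submodule_ideal_mult]
  unfolding t_mult_def by blast

lemma t_mult_memI:
  assumes "I \<in> fractional_t_ideals R" "J \<in> fractional_t_ideals R" "x \<in> I" "y \<in> J"
  shows "x * y \<in> t_mult R I J"
  using t_closure_incl[OF submodule_ideal_mult ideal_mult_fractional(1)[OF assms(1,2)]]
    ideal_mult_memI[OF assms(3,4)] unfolding t_mult_def by blast

text \<open>The t-product of \<open>I\<close> and \<open>J\<close> is the least t-ideal that contains all products. The factor \<open>c\<close>
  allows iterating the rule for products of three ideals.\<close>
lemma t_mult_minimal: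
  assumes L: "L \<in> fractional_t_ideals R"
    and "\<And>x y. x \<in> I \<Longrightarrow> y \<in> J \<Longrightarrow> c * (x * y) \<in> L" and z: "z \<in> t_mult R I J"
  shows "c * z \<in> L"
proof (rule t_ideal_mult_closed[OF L submodule_ideal_mult _ z[unfolded t_mult_def]])
  fix x assume "x \<in> ideal_mult R I J"
  moreover have "ideal_mult R I J \<subseteq> {x. c * x \<in> L}"
    using assms by (intro ideal_mult_minimal submodule_colon_preimage t_idealD(1)) auto
  ultimately show "c * x \<in> L" by blast
qed

lemma t_mult_subset:
  assumes "L \<in> fractional_t_ideals R" "\<And>x y. x \<in> I \<Longrightarrow> y \<in> J \<Longrightarrow> x * y \<in> L"
  shows "t_mult R I J \<subseteq> L"
  using t_mult_minimal[OF assms(1), of I J 1] assms(2) by auto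

lemma t_mult_commute: "t_mult R I J = t_mult R J I"
proof -
  have "{x * y |x y. x \<in> I \<and> y \<in> J} = {x * y |x y. x \<in> J \<and> y \<in> I}"
    by (auto; metis mult.commute)
  thus ?thesis by (simp add: t_mult_def ideal_mult_def)
qed

lemma t_mult_assoc_subset:
  assumes "I \<in> fractional_t_ideals R" "J \<in> fractional_t_ideals R" "L \<in> fractional_t_ideals R"
  shows "t_mult R (t_mult R I J) L \<subseteq> t_mult R I (t_mult R J L)"
proof (rule t_mult_subset)
  have JL: "t_mult R J L \<in> fractional_t_ideals R" using assms t_mult_t_ideal by blast
  thus T: "t_mult R I (t_mult R J L) \<in> fractional_t_ideals R" using assms t_mult_t_ideal by blast
  fix x z assume x: "x \<in> t_mult R I J" and z: "z \<in> L"
  have "z * x \<in> t_mult R I (t_mult R J L)"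
  proof (rule t_mult_minimal[OF T _ x])
    fix u v assume "u \<in> I" "v \<in> J"
    hence "u * (v * z) \<in> t_mult R I (t_mult R J L)"
      using t_mult_memI assms JL z by blast
    thus "z * (u * v) \<in> t_mult R I (t_mult R J L)" by (simp add: mult_ac)
  qed
  thus "x * z \<in> t_mult R I (t_mult R J L)" by (simp add: mult.commute)
qed

lemma t_mult_assoc:
  assumes "I \<in> fractional_t_ideals R" "J \<in> fractional_t_ideals R" "L \<in> fractional_t_ideals R"
  shows "t_mult R (t_mult R I J) L = t_mult R I (t_mult R J L)"
  using t_mult_assoc_subset[OF assms] t_mult_assoc_subset[OF assms(3,2,1)]
  by (simp add: t_mult_commute)

lemma scale_t_ideal:
  assumes I: "I \<in> fractional_t_ideals R" and c: "c \<noteq> 0"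
  shows "(*) c ` I \<in> fractional_t_ideals R"
proof -
  have sub: "submodule R ((*) c ` I)"
  proof -
    have "(*) c ` I = {x. inverse c * x \<in> I}"
    proof
      show "{x. inverse c * x \<in> I} \<subseteq> (*) c ` I"
      proof
        fix x assume "x \<in> {x. inverse c * x \<in> I}"
        moreover have "x = c * (inverse c * x)" using c by simp
        ultimately show "x \<in> (*) c ` I" by blast
      qed
    qed (use c in \<open>auto simp: mult.assoc[symmetric]\<close>)
    thus ?thesis using submodule_colon_preimage[OF t_idealD(1)[OF I]] by simp
  qed
  have ne: "(*) c ` I \<noteq> {0}"
    using nonzero_element[OF t_idealD(1,2)[OF I]] c
    by (metis image_eqI mult_eq_0_iff singletonD)
  obtain d where d: "d \<in> R" "d \<noteq> 0" "\<forall>x\<in>I. d * x \<in> R" using t_idealD(4)[OF I] by blast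
  obtain a b where ab: "a \<in> R" "b \<in> R" "b \<noteq> 0" "c = a / b" by (rule quotient)
  have fr: "(d * b) * x \<in> R" if "x \<in> (*) c ` I" for x
  proof -
    from that obtain y where "y \<in> I" "x = c * y" by blast
    moreover from this(1) have "a * (d * y) \<in> R" using d ab R_mult by blast
    moreover have "(d * b) * (c * y) = a * (d * y)" using ab by simp
    ultimately show ?thesis by (simp only:)
  qed
  have db: "d * b \<in> R" "d * b \<noteq> 0" using d ab R_mult by auto
  have "t_closure R ((*) c ` I) \<subseteq> (*) c ` I"
  proof
    fix x assume "x \<in> t_closure R ((*) c ` I)"
    hence "inverse c * x \<in> I"
      by (rule t_ideal_mult_closed[OF I sub, rotated])
        (use c in \<open>auto simp: mult.assoc[symmetric]\<close>)
    moreover have "x = c * (inverse c * x)" using c by simp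
    ultimately show "x \<in> (*) c ` I" by blast
  qed
  hence "t_closure R ((*) c ` I) = (*) c ` I" using t_closure_incl[OF sub ne] by blast
  thus ?thesis using sub ne fr db unfolding fractional_t_ideals_def fractional_ideal_def by blast
qed

lemma t_mult_scale:
  assumes "I \<in> fractional_t_ideals R" "J \<in> fractional_t_ideals R" "c \<noteq> 0"
  shows "t_mult R ((*) c ` I) J = (*) c ` t_mult R I J"
proof
  have cI: "(*) c ` I \<in> fractional_t_ideals R" by (rule scale_t_ideal[OF assms(1,3)])
  show "t_mult R ((*) c ` I) J \<subseteq> (*) c ` t_mult R I J"
  proof (rule t_mult_subset)
    show "(*) c ` t_mult R I J \<in> fractional_t_ideals R"
      by (intro scale_t_ideal t_mult_t_ideal assms)
    fix x y assume "x \<in> (*) c ` I" "y \<in> J"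
    then obtain z where "z \<in> I" "x * y = c * (z * y)" by auto
    thus "x * y \<in> (*) c ` t_mult R I J" using t_mult_memI[OF assms(1,2) _ \<open>y \<in> J\<close>] by blast
  qed
  have "c * z \<in> t_mult R ((*) c ` I) J" if "z \<in> t_mult R I J" for z
  proof (rule t_mult_minimal[OF t_mult_t_ideal[OF cI assms(2)] _ that])
    fix x y assume "x \<in> I" "y \<in> J"
    thus "c * (x * y) \<in> t_mult R ((*) c ` I) J"
      using t_mult_memI[OF cI assms(2) imageI[of x I "(*) c"]] by (simp add: mult.assoc)
  qed
  thus "(*) c ` t_mult R I J \<subseteq> t_mult R ((*) c ` I) J" by blast
qed

lemma principal_equiv_iff:
  "(I, J) \<in> principal_equiv R \<longleftrightarrow>
     J \<in> fractional_t_ideals R \<and> (\<exists>c. c \<noteq> 0 \<and> I = (*) c ` J)"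
  unfolding principal_equiv_def using scale_t_ideal by blast

lemma equiv_principal_equiv: "equiv (fractional_t_ideals R) (principal_equiv R)"
proof (rule equivI)
  show "principal_equiv R \<subseteq> fractional_t_ideals R \<times> fractional_t_ideals R"
    unfolding principal_equiv_def by blast
  have "(I, I) \<in> principal_equiv R" if "I \<in> fractional_t_ideals R" for I
  proof -
    have "I = (*) 1 ` I" by simp
    thus ?thesis unfolding principal_equiv_iff using that zero_neq_one by metis
  qed
  thus "refl_on (fractional_t_ideals R) (principal_equiv R)" by (rule refl_onI)
  show "sym (principal_equiv R)"
  proof (rule symI)
    fix I J assume "(I, J) \<in> principal_equiv R"
    then obtain c where c: "c \<noteq> 0" "J \<in> fractional_t_ideals R" "I = (*) c ` J"
      unfolding principal_equiv_iff by blast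
    have "J = (*) (inverse c) ` I" using c(1) unfolding c(3) image_image by (simp add: mult.assoc[symmetric])
    moreover have "I \<in> fractional_t_ideals R" unfolding c(3) by (rule scale_t_ideal[OF c(2,1)])
    ultimately show "(J, I) \<in> principal_equiv R"
      unfolding principal_equiv_iff using c(1) nonzero_imp_inverse_nonzero by blast
  qed
  show "trans (principal_equiv R)"
  proof (rule transI)
    fix I J L assume "(I, J) \<in> principal_equiv R" "(J, L) \<in> principal_equiv R"
    then obtain c d where cd: "c \<noteq> 0" "d \<noteq> 0" "L \<in> fractional_t_ideals R" "I = (*) c ` (*) d ` L"
      unfolding principal_equiv_iff by blast
    have "I = (*) (c * d) ` L" unfolding cd(4) image_image by (simp add: mult.assoc)
    moreover have "c * d \<noteq> 0" using cd by simp
    ultimately show "(I, L) \<in> principal_equiv R" unfolding principal_equiv_iff using cd(3) by blast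
  qed
qed

lemma t_class_mult_class:
  assumes "I \<in> fractional_t_ideals R" "J \<in> fractional_t_ideals R"
  shows "t_class_mult R (principal_equiv R `` {I}) (principal_equiv R `` {J})
    = principal_equiv R `` {t_mult R I J}"
proof -
  note eq = equiv_principal_equiv
  have "congruent2 (principal_equiv R) (principal_equiv R)
      (\<lambda>I J. principal_equiv R `` {t_mult R I J})"
  proof (rule congruent2_commuteI[OF eq])
    fix I J L assume *: "(I, J) \<in> principal_equiv R" and L: "L \<in> fractional_t_ideals R"
    then obtain c where c: "c \<noteq> 0" "J \<in> fractional_t_ideals R" "I = (*) c ` J"
      unfolding principal_equiv_iff by blast
    have "(t_mult R I L, t_mult R J L) \<in> principal_equiv R"
      unfolding principal_equiv_iff
      using t_mult_scale[OF c(2) L c(1)] t_mult_t_ideal[OF c(2) L] c by blast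
    hence "principal_equiv R `` {t_mult R I L} = principal_equiv R `` {t_mult R J L}"
      by (rule equiv_class_eq[OF eq])
    thus "principal_equiv R `` {t_mult R L I} = principal_equiv R `` {t_mult R L J}"
      by (simp add: t_mult_commute)
  qed (simp add: t_mult_commute)
  thus ?thesis unfolding t_class_mult_def by (rule UN_equiv_class2[OF eq eq _ assms])
qed

text \<open>An equation between classes holds for the ideals up to a factor \<open>c\<close>, which can be moved into the
  witness \<open>J\<close>.\<close>
lemma clifford_t_regular_iff:
  "clifford_t_regular R \<longleftrightarrow>
    (\<forall>I\<in>fractional_t_ideals R. \<exists>J\<in>fractional_t_ideals R. t_mult R (t_mult R I I) J = I)"
proof -
  let ?F = "fractional_t_ideals R" and ?c = "\<lambda>I. principal_equiv R `` {I}"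
  have S: "t_class_semigroup R = ?c ` ?F" unfolding t_class_semigroup_def quotient_def by blast
  have closed: "t_class_mult R (?c I) (?c J) \<in> ?c ` ?F" if "I \<in> ?F" "J \<in> ?F" for I J
    unfolding t_class_mult_class[OF that] using t_mult_t_ideal[OF that] by (rule imageI)
  have comm: "t_class_mult R (?c I) (?c J) = t_class_mult R (?c J) (?c I)"
    if "I \<in> ?F" "J \<in> ?F" for I J
    unfolding t_class_mult_class[OF that] t_class_mult_class[OF that(2,1)]
    by (simp only: t_mult_commute[of I J])
  have assoc: "t_class_mult R (t_class_mult R (?c I) (?c J)) (?c L)
      = t_class_mult R (?c I) (t_class_mult R (?c J) (?c L))"
    if "I \<in> ?F" "J \<in> ?F" "L \<in> ?F" for I J L
    using that by (simp only: t_class_mult_class t_mult_t_ideal t_mult_assoc)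
  have comm: "comm_semigroup_on (t_class_semigroup R) (t_class_mult R)"
    unfolding comm_semigroup_on_def S using closed comm assoc by blast
  have "(\<exists>J\<in>?F. ?c (t_mult R (t_mult R I I) J) = ?c I) \<longleftrightarrow>
      (\<exists>J\<in>?F. t_mult R (t_mult R I I) J = I)" if I: "I \<in> ?F" for I
  proof
    assume "\<exists>J\<in>?F. ?c (t_mult R (t_mult R I I) J) = ?c I"
    then obtain J where J: "J \<in> ?F" "?c (t_mult R (t_mult R I I) J) = ?c I" by blast
    have "(I, t_mult R (t_mult R I I) J) \<in> principal_equiv R"
      using J I eq_equiv_class[OF J(2)[symmetric] equiv_principal_equiv] t_mult_t_ideal by blast
    then obtain c where c: "c \<noteq> 0" "I = (*) c ` t_mult R (t_mult R I I) J"
      unfolding principal_equiv_iff by blast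
    have "t_mult R (t_mult R I I) ((*) c ` J) = (*) c ` t_mult R (t_mult R I I) J"
      using t_mult_scale[OF J(1) t_mult_t_ideal[OF I I] c(1)] by (simp only: t_mult_commute)
    also have "\<dots> = I" by (rule c(2)[symmetric])
    finally show "\<exists>J\<in>?F. t_mult R (t_mult R I I) J = I" using scale_t_ideal[OF J(1) c(1)] by blast
  next
    assume "\<exists>J\<in>?F. t_mult R (t_mult R I I) J = I"
    thus "\<exists>J\<in>?F. ?c (t_mult R (t_mult R I I) J) = ?c I" by (elim bexE) (metis)
  qed
  moreover have "clifford_t_regular R \<longleftrightarrow>
      (\<forall>I\<in>?F. \<exists>J\<in>?F. t_class_mult R (t_class_mult R (?c I) (?c I)) (?c J) = ?c I)"
    unfolding clifford_t_regular_def clifford_semigroup_def using comm by (simp add: S)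
  ultimately show ?thesis
    by (simp only: t_class_mult_class t_mult_t_ideal cong: ball_cong bex_cong)
qed

section \<open>Maximal t-ideals and localization\<close>

lemma integral_t_idealI:
  assumes "submodule R I" "I \<noteq> {0}" "I \<subseteq> R"
    and "\<And>F x. finite F \<Longrightarrow> F \<subseteq> I \<Longrightarrow> \<not> F \<subseteq> {0} \<Longrightarrow> x \<in> v_closure R F \<Longrightarrow> x \<in> I"
  shows "I \<in> fractional_t_ideals R"
proof -
  have "t_closure R I \<subseteq> I"
  proof
    fix x assume "x \<in> t_closure R I"
    then obtain F where "finite F" "F \<subseteq> I" "\<not> F \<subseteq> {0}" "x \<in> v_closure R F"
      unfolding t_closure_iff[OF assms(1)] by blast
    thus "x \<in> I" by (rule assms(4))
  qed
  hence "t_closure R I = I" using t_closure_incl[OF assms(1,2)] by blast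
  thus ?thesis using t_closure_t_ideal[OF assms(1,2), of 1] assms(3) by auto
qed

lemma v_closure_subset_R: "F \<subseteq> R \<Longrightarrow> v_closure R F \<subseteq> R"
proof
  fix x assume F: "F \<subseteq> R" and "x \<in> v_closure R F"
  hence "(\<forall>f\<in>F. 1 * f \<in> R) \<longrightarrow> x * 1 \<in> R" unfolding v_closure_iff by blast
  thus "x \<in> R" using F by auto
qed

lemma R_t_ideal: "R \<in> fractional_t_ideals R"
proof (rule integral_t_idealI[OF submodule_R])
  show "R \<noteq> {0}" using R_one by (metis singletonD zero_neq_one)
qed (use v_closure_subset_R in auto)

lemma submodule_eq_R: "submodule R I \<Longrightarrow> I \<subseteq> R \<Longrightarrow> 1 \<in> I \<Longrightarrow> I = R"
  using submoduleD(3)[of I _ 1] by fastforce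

lemma proper_t_ideal_iff:
  "I \<in> proper_integral_t_ideals R \<longleftrightarrow> I \<in> fractional_t_ideals R \<and> I \<subseteq> R \<and> 1 \<notin> I"
  using submodule_eq_R[of I] t_idealD(1)[of I]
  by (auto simp: proper_integral_t_ideals_def integral_ideal_def)

text \<open>Zorn's lemma applies because membership in a t-closure is witnessed by a finite set: the union of
  a chain of t-ideals is a t-ideal.\<close>
lemma exists_t_maximal:
  assumes "submodule R E" "E \<noteq> {0}" "E \<subseteq> R" "1 \<notin> t_closure R E"
  obtains M where "t_maximal_ideal R M" "E \<subseteq> M"
proof -
  define \<A> where "\<A> = {I \<in> proper_integral_t_ideals R. E \<subseteq> I}"
  have "\<exists>M\<in>\<A>. \<forall>X\<in>\<A>. M \<subseteq> X \<longrightarrow> X = M"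
  proof (rule subset_Zorn_nonempty)
    have "t_closure R E \<in> fractional_t_ideals R"
      using t_closure_t_ideal[OF assms(1,2), of 1] assms(3) by auto
    moreover have "t_closure R E \<subseteq> R" using t_closure_mono[OF assms(3)] t_idealD(3)[OF R_t_ideal] by simp
    ultimately have "t_closure R E \<in> \<A>"
      using assms(4) t_closure_incl[OF assms(1,2)] by (simp add: \<A>_def proper_t_ideal_iff)
    thus "\<A> \<noteq> {}" by blast
  next
    fix \<C> assume C: "\<C> \<noteq> {}" "subset.chain \<A> \<C>"
    hence CA: "I \<in> fractional_t_ideals R" "I \<subseteq> R" "1 \<notin> I" "E \<subseteq> I" if "I \<in> \<C>" for I
      using that unfolding subset_chain_def \<A>_def by (auto simp: proper_t_ideal_iff)
    have fin: "\<exists>I\<in>\<C>. F \<subseteq> I" if "finite F" "F \<subseteq> \<Union>\<C>" for F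
      using finite_subset_Union_chain[OF that C] by metis
    have sub: "submodule R (\<Union>\<C>)"
      unfolding submodule_def
    proof (intro conjI ballI)
      show "0 \<in> \<Union>\<C>" using C(1) submoduleD(1)[OF t_idealD(1)[OF CA(1)]] by blast
    next
      fix x y assume "x \<in> \<Union>\<C>" "y \<in> \<Union>\<C>"
      then obtain I where "I \<in> \<C>" "{x, y} \<subseteq> I" using fin[of "{x, y}"] by auto
      thus "x + y \<in> \<Union>\<C>" using submoduleD(2)[OF t_idealD(1)[OF CA(1)]] by blast
    next
      fix r x assume "r \<in> R" "x \<in> \<Union>\<C>"
      thus "r * x \<in> \<Union>\<C>" using submoduleD(3)[OF t_idealD(1)[OF CA(1)]] by blast
    qed
    have E: "E \<subseteq> \<Union>\<C>" using C(1) CA(4) by blast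
    have "\<Union>\<C> \<in> fractional_t_ideals R"
    proof (rule integral_t_idealI[OF sub])
      obtain z where "z \<in> E" "z \<noteq> 0" by (rule nonzero_element[OF assms(1,2)])
      thus "\<Union>\<C> \<noteq> {0}" using E by blast
      show "\<Union>\<C> \<subseteq> R" using CA(2) by blast
      fix F x assume F: "finite F" "F \<subseteq> \<Union>\<C>" "\<not> F \<subseteq> {0}" "x \<in> v_closure R F"
      then obtain I where I: "I \<in> \<C>" "F \<subseteq> I" using fin by blast
      hence "x \<in> t_closure R I" using F by (intro t_closureI[OF t_idealD(1)[OF CA(1)]])
      thus "x \<in> \<Union>\<C>" using I t_idealD(3)[OF CA(1)[OF I(1)]] by auto
    qed
    thus "\<Union>\<C> \<in> \<A>" using CA(2,3) E by (auto simp: \<A>_def proper_t_ideal_iff)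
  qed
  then obtain M where M: "M \<in> \<A>" "\<And>X. X \<in> \<A> \<Longrightarrow> M \<subseteq> X \<Longrightarrow> X = M" by blast
  hence "t_maximal_ideal R M" unfolding t_maximal_ideal_def \<A>_def by blast
  moreover have "E \<subseteq> M" using M(1) unfolding \<A>_def by blast
  ultimately show ?thesis by (rule that)
qed

lemma t_maximalD:
  assumes "t_maximal_ideal R M"
  shows "M \<in> fractional_t_ideals R" "M \<subseteq> R" "1 \<notin> M" "submodule R M" "M \<noteq> {0}"
  using assms t_idealD(1,2)[of M] by (auto simp: t_maximal_ideal_def proper_t_ideal_iff)

text \<open>If \<open>a b \<in> M\<close>, then the elements \<open>r\<close> of \<open>R\<close> with \<open>a r \<in> M\<close> form a t-ideal that contains \<open>M\<close>
  and \<open>b\<close>; it is \<open>R\<close> or \<open>M\<close> by maximality.\<close>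
lemma t_maximal_prime:
  assumes M: "t_maximal_ideal R M"
  shows "prime_ideal R M"
  unfolding prime_ideal_def integral_ideal_def
proof (intro conjI ballI impI)
  note D = t_maximalD[OF M]
  show "submodule R M" "M \<subseteq> R" "M \<noteq> R" using D R_one by auto
  fix a b assume ab: "a \<in> R" "b \<in> R" "a * b \<in> M"
  define N where "N = {r \<in> R. a * r \<in> M}"
  have sub: "submodule R N"
    using submodule_colon_preimage[OF D(4), of a] submodule_R
    unfolding N_def submodule_def by blast
  have MN: "M \<subseteq> N" using D(2) submoduleD(3)[OF D(4) ab(1)] unfolding N_def by blast
  have "N \<in> fractional_t_ideals R"
  proof (rule integral_t_idealI[OF sub])
    obtain z where "z \<in> M" "z \<noteq> 0" by (rule nonzero_element[OF D(4,5)])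
    thus "N \<noteq> {0}" using MN by blast
    show "N \<subseteq> R" by (auto simp: N_def)
    fix F x assume F: "finite F" "F \<subseteq> N" "\<not> F \<subseteq> {0}" "x \<in> v_closure R F"
    hence x: "x \<in> t_closure R N" by (rule t_closureI[OF sub])
    have "a * x \<in> M"
      by (rule t_ideal_mult_closed[OF D(1) sub _ x]) (auto simp: N_def)
    moreover have "x \<in> R" using F(2,4) v_closure_subset_R[of F] unfolding N_def by blast
    ultimately show "x \<in> N" by (simp add: N_def)
  qed
  moreover have "N \<subseteq> R" unfolding N_def by blast
  ultimately have "1 \<notin> N \<Longrightarrow> N \<in> proper_integral_t_ideals R"
    unfolding proper_t_ideal_iff by (intro conjI)
  hence "1 \<notin> N \<Longrightarrow> N = M" using M MN by (simp add: t_maximal_ideal_def)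
  moreover have "1 \<in> N \<longleftrightarrow> a \<in> M" "b \<in> N" using ab unfolding N_def by simp_all
  ultimately show "a \<in> M \<or> b \<in> M" by blast
qed

lemma t_maximal_not_subset:
  assumes "t_maximal_ideal R M" "t_maximal_ideal R N" "M \<noteq> N"
  obtains m where "m \<in> M" "m \<in> R - N"
proof -
  have "N \<in> proper_integral_t_ideals R" using assms(2) by (simp add: t_maximal_ideal_def)
  hence "\<not> M \<subseteq> N" using assms(1,3) by (auto simp: t_maximal_ideal_def)
  then obtain m where "m \<in> M" "m \<notin> N" by blast
  thus ?thesis using that[of m] t_maximalD(2)[OF assms(1)] by auto
qed

lemma prime_idealD:
  assumes "prime_ideal R P"
  shows "submodule R P" "P \<subseteq> R" "1 \<in> R - P"
    and "s \<in> R - P \<Longrightarrow> t \<in> R - P \<Longrightarrow> s * t \<in> R - P"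
    and "s \<in> R - P \<Longrightarrow> x \<in> R \<Longrightarrow> s * x \<in> P \<Longrightarrow> x \<in> P"
    and "s \<in> R - P \<Longrightarrow> s \<noteq> 0"
  using assms submodule_eq_R[of P] submoduleD(1)[of P] R_mult
  by (auto simp: prime_ideal_def integral_ideal_def)

lemma localizeI: "s \<in> R - P \<Longrightarrow> s * x \<in> I \<Longrightarrow> x \<in> localize R P I"
  by (auto simp: localize_def)

lemma localizeE:
  assumes "x \<in> localize R P I" obtains s where "s \<in> R - P" "s * x \<in> I"
  using assms by (auto simp: localize_def)

lemma localize_incl: "prime_ideal R P \<Longrightarrow> I \<subseteq> localize R P I"
  using prime_idealD(3) by (fastforce intro: localizeI[of 1])

lemma localize_mult:
  assumes P: "prime_ideal R P" and I: "submodule R I"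
    and x: "x \<in> localize R P R" and y: "y \<in> localize R P I"
  shows "x * y \<in> localize R P I"
proof -
  obtain s where s: "s \<in> R - P" "s * x \<in> R" by (rule localizeE[OF x])
  obtain t where t: "t \<in> R - P" "t * y \<in> I" by (rule localizeE[OF y])
  have "(s * t) * (x * y) = (s * x) * (t * y)" by simp
  hence "(s * t) * (x * y) \<in> I" using submoduleD(3)[OF I s(2) t(2)] by (simp only:)
  thus ?thesis using prime_idealD(4)[OF P s(1) t(1)] by (rule localizeI[rotated])
qed

lemma submodule_localize:
  assumes P: "prime_ideal R P" and I: "submodule R I"
  shows "submodule R (localize R P I)"
  unfolding submodule_def
proof (intro conjI ballI)
  show "0 \<in> localize R P I" using localize_incl[OF P] submoduleD(1)[OF I] by blast
  fix x y assume x: "x \<in> localize R P I" and y: "y \<in> localize R P I"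
  obtain s where s: "s \<in> R - P" "s * x \<in> I" by (rule localizeE[OF x])
  obtain t where t: "t \<in> R - P" "t * y \<in> I" by (rule localizeE[OF y])
  have "(s * t) * (x + y) = t * (s * x) + s * (t * y)" by (simp add: algebra_simps)
  hence "(s * t) * (x + y) \<in> I" using submoduleD(2,3)[OF I] s t by auto
  thus "x + y \<in> localize R P I" using prime_idealD(4)[OF P s(1) t(1)] by (rule localizeI[rotated])
next
  fix r x assume "r \<in> R" "x \<in> localize R P I"
  thus "r * x \<in> localize R P I" using localize_mult[OF P I] localize_incl[OF P] by blast
qed

lemma localize_common_denominator:
  assumes P: "prime_ideal R P" and I: "submodule R I"
    and "finite F" "F \<subseteq> localize R P I"
  obtains s where "s \<in> R - P" "\<And>f. f \<in> F \<Longrightarrow> s * f \<in> I"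
proof -
  have "\<exists>s\<in>R - P. \<forall>f\<in>F. s * f \<in> I"
    using assms(3,4)
  proof (induction F)
    case empty
    show ?case using prime_idealD(3)[OF P] by blast
  next
    case (insert x F)
    then obtain s where s: "s \<in> R - P" "\<forall>f\<in>F. s * f \<in> I" by auto
    obtain t where t: "t \<in> R - P" "t * x \<in> I" using insert.prems by (auto elim: localizeE)
    have "(s * t) * f \<in> I" if "f \<in> insert x F" for f
    proof (cases "f = x")
      case True
      thus ?thesis using submoduleD(3)[OF I, of s "t * x"] s t by (simp add: mult.assoc)
    next
      case False
      thus ?thesis using submoduleD(3)[OF I, of t "s * f"] s t that by (simp add: mult_ac)
    qed
    thus ?case using prime_idealD(4)[OF P s(1) t(1)] by blast
  qed
  thus ?thesis using that by blast
qed

lemma localization_at_eq: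
  assumes P: "prime_ideal R P"
  shows "localization_at R P = localize R P R"
proof
  show "localization_at R P \<subseteq> localize R P R"
  proof
    fix x assume "x \<in> localization_at R P"
    then obtain a s where s: "s \<in> R - P" and "a \<in> R" "x = a / s"
      unfolding localization_at_def by blast
    hence "s * x \<in> R" using prime_idealD(6)[OF P s] by simp
    thus "x \<in> localize R P R" by (rule localizeI[OF s])
  qed
  show "localize R P R \<subseteq> localization_at R P"
  proof
    fix x assume "x \<in> localize R P R"
    then obtain s where s: "s \<in> R - P" "s * x \<in> R" by (rule localizeE)
    have "x = (s * x) / s" using prime_idealD(6)[OF P s(1)] by simp
    thus "x \<in> localization_at R P" using s unfolding localization_at_def by blast
  qed
qed

lemma is_subring_localize:
  assumes P: "prime_ideal R P" shows "is_subring (localize R P R)"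
  unfolding is_subring_def
proof (intro conjI ballI)
  note sub = submodule_localize[OF P submodule_R]
  show "0 \<in> localize R P R" "1 \<in> localize R P R" using localize_incl[OF P, of R] by auto
  fix x y assume xy: "x \<in> localize R P R" "y \<in> localize R P R"
  show "x * y \<in> localize R P R" by (rule localize_mult[OF P submodule_R xy])
  have "- 1 * y \<in> localize R P R"
    using submoduleD(3)[OF sub, of "-1" y] R_diff[of 0 1] xy by simp
  thus "x - y \<in> localize R P R" using submoduleD(2)[OF sub xy(1)] by fastforce
qed

text \<open>The ideal \<open>E\<close> of all \<open>r\<close> in \<open>R\<close> with \<open>x r \<in> I\<close> is contained in no maximal t-ideal, hence
  \<open>1 \<in> E\<^sub>t\<close>. Multiplication by \<open>x\<close> maps \<open>E\<close> into \<open>I\<close> and therefore \<open>E\<^sub>t\<close> into \<open>I\<^sub>t\<close>.\<close>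
lemma mem_t_closureI_local:
  assumes I: "submodule R I" "I \<noteq> {0}"
    and loc: "\<And>M. t_maximal_ideal R M \<Longrightarrow> x \<in> localize R M I"
  shows "x \<in> t_closure R I"
proof -
  define E where "E = {r \<in> R. x * r \<in> I}"
  have sub: "submodule R E"
    using submodule_colon_preimage[OF I(1), of x] submodule_R
    unfolding E_def submodule_def by blast
  obtain z where z: "z \<in> I" "z \<noteq> 0" by (rule nonzero_element[OF I])
  obtain a b where ab: "a \<in> R" "b \<in> R" "b \<noteq> 0" "x = a / b" by (rule quotient)
  obtain c d where cd: "c \<in> R" "d \<in> R" "d \<noteq> 0" "z = c / d" by (rule quotient)
  have "x * (b * c) = (a * d) * z" using ab cd by simp
  hence "x * (b * c) \<in> I" using submoduleD(3)[OF I(1) _ z(1)] R_mult[OF ab(1) cd(2)] by simp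
  moreover have "b * c \<noteq> 0" using ab cd z by auto
  ultimately have "E \<noteq> {0}" using R_mult[OF ab(2) cd(1)] unfolding E_def by blast
  have "1 \<in> t_closure R E"
  proof (rule ccontr)
    assume "1 \<notin> t_closure R E"
    moreover have "E \<subseteq> R" by (auto simp: E_def)
    ultimately obtain M where M: "t_maximal_ideal R M" "E \<subseteq> M"
      using exists_t_maximal[OF sub \<open>E \<noteq> {0}\<close>] by blast
    obtain s where "s \<in> R - M" "s * x \<in> I" by (rule localizeE[OF loc[OF M(1)]])
    thus False using M(2) by (auto simp: E_def mult.commute)
  qed
  moreover have "x * r \<in> t_closure R I" if "r \<in> E" for r
    using that t_closure_incl[OF I] unfolding E_def by blast
  ultimately have "x * 1 \<in> t_closure R I" by (rule t_closure_mult[OF sub I, rotated])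
  thus ?thesis by simp
qed

lemma mem_R_local:
  assumes "\<And>M. t_maximal_ideal R M \<Longrightarrow> x \<in> localize R M R"
  shows "x \<in> R"
  using mem_t_closureI_local[OF submodule_R t_idealD(2)[OF R_t_ideal] assms]
    t_idealD(3)[OF R_t_ideal] by simp

section \<open>Localizing at primes with valuation rings\<close>

definition valuation_prime :: "'k set \<Rightarrow> bool" where
  "valuation_prime P \<longleftrightarrow> prime_ideal R P \<and>
     (\<forall>x. x \<noteq> 0 \<longrightarrow> x \<in> localize R P R \<or> inverse x \<in> localize R P R)"

lemma valuation_primeD:
  assumes "valuation_prime P"
  shows "prime_ideal R P" "a \<noteq> 0 \<Longrightarrow> b / a \<notin> localize R P R \<Longrightarrow> a / b \<in> localize R P R"
proof -
  show P: "prime_ideal R P" using assms by (simp add: valuation_prime_def)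
  assume "a \<noteq> 0" "b / a \<notin> localize R P R"
  moreover have "0 \<in> localize R P R" using localize_incl[OF P, of R] by auto
  ultimately have "b \<noteq> 0" by auto
  moreover note \<open>a \<noteq> 0\<close> \<open>b / a \<notin> localize R P R\<close>
  ultimately show "a / b \<in> localize R P R"
    using assms unfolding valuation_prime_def by (metis divide_eq_0_iff inverse_divide)
qed

lemma PVMD_iff: "PVMD R \<longleftrightarrow> (\<forall>M. t_maximal_ideal R M \<longrightarrow> valuation_prime M)"
  unfolding PVMD_def valuation_domain_def valuation_prime_def
  using t_maximal_prime localization_at_eq is_subring_localize by metis

text \<open>In a valuation ring the divisibility preorder is total, so among finitely many elements one
  divides all the others. The denominator \<open>s\<close> is common to all quotients.\<close>
lemma finite_local_generator:
  assumes P: "valuation_prime P" and F: "finite F" "\<not> F \<subseteq> {0}"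
  obtains a s where "a \<in> F" "a \<noteq> 0" "s \<in> R - P" "\<And>f. f \<in> F \<Longrightarrow> s * (f / a) \<in> R"
proof -
  note prime = valuation_primeD(1)[OF P]
  have "\<exists>a\<in>F. a \<noteq> 0 \<and> (\<forall>f\<in>F. f / a \<in> localize R P R)"
    using F
  proof (induction F)
    case (insert y F)
    have 0: "0 \<in> localize R P R" and 1: "1 \<in> localize R P R"
      using localize_incl[OF prime, of R] by auto
    show ?case
    proof (cases "F \<subseteq> {0}")
      case True
      hence "y \<noteq> 0" using insert.prems by auto
      moreover have "f / y \<in> localize R P R" if "f \<in> insert y F" for f
        using that True 0 1 \<open>y \<noteq> 0\<close> by auto
      ultimately show ?thesis by blast
    next
      case False
      then obtain a where a: "a \<in> F" "a \<noteq> 0" "\<forall>f\<in>F. f / a \<in> localize R P R"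
        using insert.IH by blast
      show ?thesis
      proof (cases "y / a \<in> localize R P R")
        case True
        thus ?thesis using a by blast
      next
        case False
        hence ay: "a / y \<in> localize R P R" using valuation_primeD(2)[OF P a(2)] by blast
        have y: "y \<noteq> 0" using False 0 by auto
        have "f / y \<in> localize R P R" if "f \<in> insert y F" for f
        proof (cases "f = y")
          case False
          hence "f / a * (a / y) \<in> localize R P R"
            using a that localize_mult[OF prime submodule_R _ ay] by blast
          thus ?thesis using a by simp
        qed (use 1 y in simp)
        thus ?thesis using y by blast
      qed
    qed
  qed simp
  then obtain a where a: "a \<in> F" "a \<noteq> 0" "\<forall>f\<in>F. f / a \<in> localize R P R" by blast
  have "finite ((\<lambda>f. f / a) ` F)" "(\<lambda>f. f / a) ` F \<subseteq> localize R P R" using a F by auto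
  from localize_common_denominator[OF prime submodule_R this] obtain s
    where s: "s \<in> R - P" "\<And>f. f \<in> (\<lambda>f. f / a) ` F \<Longrightarrow> s * f \<in> R" by blast
  show ?thesis using that[OF a(1,2) s(1)] s(2) by blast
qed

text \<open>If \<open>a \<in> F\<close> divides the finite set \<open>F \<subseteq> I\<close> locally, then \<open>s / a \<in> F\<^sup>-\<^sup>1\<close> for some \<open>s\<close> outside \<open>P\<close>,
  which puts the v-closure of \<open>F\<close> into \<open>a R\<^sub>P \<subseteq> I R\<^sub>P\<close>.\<close>
lemma t_closure_subset_localize:
  assumes P: "valuation_prime P" and I: "submodule R I"
  shows "t_closure R I \<subseteq> localize R P I"
proof
  fix x assume "x \<in> t_closure R I"
  then obtain F where F: "finite F" "F \<subseteq> I" "\<not> F \<subseteq> {0}" "x \<in> v_closure R F"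
    unfolding t_closure_iff[OF I] by blast
  obtain a s where a: "a \<in> F" "a \<noteq> 0" "s \<in> R - P" and s: "\<And>f. f \<in> F \<Longrightarrow> s * (f / a) \<in> R"
    using finite_local_generator[OF P F(1,3)] by blast
  have "\<forall>f\<in>F. (s / a) * f \<in> R" using s by simp
  hence "x * (s / a) \<in> R" using F(4) unfolding v_closure_iff by blast
  moreover have "s * x = x * (s / a) * a" using a(2) by simp
  ultimately have "s * x \<in> I" using submoduleD(3)[OF I, of "x * (s / a)" a] F(2) a(1) by auto
  thus "x \<in> localize R P I" by (rule localizeI[OF a(3)])
qed

section \<open>Krull-type domains are pseudo-integrally closed and Clifford t-regular\<close>

text \<open>A finitely generated \<open>I\<close> satisfies \<open>I\<^sub>t R\<^sub>M = a R\<^sub>M\<close> for each maximal t-ideal \<open>M\<close>, so a multiplier of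
  \<open>I\<^sub>t\<close> lies in every \<open>R\<^sub>M\<close>.\<close>
lemma PVMD_imp_pseudo_integrally_closed:
  assumes "PVMD R" shows "pseudo_integrally_closed R"
  unfolding pseudo_integrally_closed_def
proof
  have "submodule R hull {1} = R"
    by (intro submodule_eq_R submodule_hull hull_minimal submodule_R) (auto intro: hull_inc)
  hence "finitely_generated R R" unfolding finitely_generated_def by (metis finite.intros)
  moreover have "t_closure R R = R" "R \<noteq> {0}" using t_idealD[OF R_t_ideal] by auto
  moreover have "R \<subseteq> colon R R" by (auto simp: colon_def R_mult)
  moreover have "integral_ideal R R" by (simp add: integral_ideal_def submodule_R)
  ultimately show "R \<subseteq> pseudo_integral_closure R" unfolding pseudo_integral_closure_def by force
next
  show "pseudo_integral_closure R \<subseteq> R"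
  proof
    fix x assume "x \<in> pseudo_integral_closure R"
    then obtain I where I: "I \<noteq> {0}" "finitely_generated R I"
        and x: "x \<in> colon (t_closure R I) (t_closure R I)"
      unfolding pseudo_integral_closure_def by blast
    obtain F where F: "finite F" "I = submodule R hull F"
      using I(2) unfolding finitely_generated_def by blast
    have sub: "submodule R I" unfolding F(2) by (rule submodule_hull)
    have FI: "F \<subseteq> I" unfolding F(2) by (rule hull_subset)
    have "\<not> F \<subseteq> {0}"
    proof
      assume "F \<subseteq> {0}"
      hence "I \<subseteq> {0}" unfolding F(2) by (intro hull_minimal) (auto simp: submodule_def)
      thus False using I(1) submoduleD(1)[OF sub] by auto
    qed
    show "x \<in> R"
    proof (rule mem_R_local)
      fix M assume M: "t_maximal_ideal R M"
      hence V: "valuation_prime M" using assms by (simp add: PVMD_iff)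
      note prime = valuation_primeD(1)[OF V]
      obtain a s where a: "a \<in> F" "a \<noteq> 0" "s \<in> R - M" "\<And>f. f \<in> F \<Longrightarrow> s * (f / a) \<in> R"
        using finite_local_generator[OF V F(1) \<open>\<not> F \<subseteq> {0}\<close>] by blast
      have "I \<subseteq> {y. (s / a) * y \<in> R}"
        unfolding F(2) using a(4) by (intro hull_minimal submodule_colon_preimage submodule_R) auto
      moreover have "a \<in> t_closure R I" using a(1) FI t_closure_incl[OF sub I(1)] by blast
      hence "x * a \<in> t_closure R I" using x by (simp add: colon_def)
      ultimately have "(s / a) * (x * a) \<in> R"
        using t_closure_in_R[OF sub, of "s / a" "x * a"] by blast
      hence "s * x \<in> R" using a(2) by simp
      thus "x \<in> localize R M R" by (rule localizeI[OF a(3)])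
    qed
  qed
qed

text \<open>The element \<open>a\<close> generates \<open>W = I R\<^sub>M\<close> over its ring of multipliers, in a form that avoids naming this
  ring. The elements \<open>r\<close> of \<open>R\<close> with \<open>W / r \<subseteq> W\<close> form a multiplicative set \<open>S\<close>, whose complement is
  a t-prime \<open>Q \<subseteq> M\<close>. Strong t-discreteness gives an element \<open>q\<close> of \<open>Q\<close> outside \<open>(Q\<^sup>2)\<^sub>t\<close>, and
  \<open>q\<close> generates \<open>Q R\<^sub>Q\<close>. If no \<open>a\<close> were suitable, then \<open>W = Q W\<close>, hence \<open>W = q W\<close>, which contradicts
  \<open>q \<notin> S\<close>.\<close>
lemma square_locally_in_multiple:
  assumes PVMD: "PVMD R" and discrete: "strongly_t_discrete R" and M: "t_maximal_ideal R M"
    and I: "I \<in> fractional_t_ideals R" "I \<subseteq> R"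
  obtains a where "a \<in> I" "a \<noteq> 0" "\<And>x y. x \<in> I \<Longrightarrow> y \<in> I \<Longrightarrow> x * y / a \<in> localize R M I"
proof -
  note subI = t_idealD(1)[OF I(1)]
  have V: "valuation_prime M" using PVMD M by (simp add: PVMD_iff)
  note prime = valuation_primeD(1)[OF V]
  define W where "W = localize R M I"
  define S where "S = {r \<in> R. r \<noteq> 0 \<and> (\<forall>w\<in>W. w / r \<in> W)}"
  define Q where "Q = R - S"
  have subW: "submodule R W" unfolding W_def by (rule submodule_localize[OF prime subI])
  have IW: "I \<subseteq> W" unfolding W_def by (rule localize_incl[OF prime])
  have SD: "r \<in> R" "r \<noteq> 0" "w \<in> W \<Longrightarrow> w / r \<in> W" if "r \<in> S" for r w
    using that unfolding S_def by auto
  have S_unit: "s \<in> S" if s: "s \<in> R - M" for s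
  proof -
    have s0: "s \<noteq> 0" by (rule prime_idealD(6)[OF prime s])
    have "1 / s \<in> localize R M R" using s s0 by (intro localizeI[OF s]) simp
    hence "1 / s * w \<in> W" if "w \<in> W" for w
      using that localize_mult[OF prime subI] unfolding W_def by blast
    thus ?thesis using s s0 unfolding S_def by simp
  qed
  have S_mult: "r * r' \<in> S" if r: "r \<in> S" "r' \<in> S" for r r'
  proof -
    have "w / (r * r') \<in> W" if "w \<in> W" for w
      using SD(3)[OF r(2) SD(3)[OF r(1) that]] by (simp only: divide_divide_eq_left)
    moreover have "r * r' \<in> R" "r * r' \<noteq> 0" using SD(1,2) r R_mult by auto
    ultimately show ?thesis unfolding S_def by blast
  qed
  have S_factor: "r \<in> S" if "r \<in> R" "r' \<in> R" "r * r' \<in> S" for r r'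
  proof -
    have ne: "r \<noteq> 0" "r' \<noteq> 0" using SD(2)[OF that(3)] by auto
    have "w / r \<in> W" if "w \<in> W" for w
    proof -
      have "r' * (w / (r * r')) \<in> W"
        by (intro submoduleD(3)[OF subW] SD(3) \<open>r' \<in> R\<close> \<open>r * r' \<in> S\<close> that)
      thus ?thesis using ne by simp
    qed
    thus ?thesis using that(1) ne unfolding S_def by simp
  qed

  \<comment> \<open>The complement of \<open>S\<close> is a prime t-ideal below \<open>M\<close>.\<close>
  have QM: "Q \<subseteq> M" using S_unit unfolding Q_def by blast
  have Q_absorb: "r * q \<in> Q" if "r \<in> R" "q \<in> Q" for r q
    using S_factor[of q r] that R_mult unfolding Q_def by (auto simp: mult.commute)
  have Q_add_le: "q + q' \<in> Q"
    if q: "q \<in> Q" "q' \<in> Q" "q \<noteq> 0" and le: "q' / q \<in> localize R M R" for q q'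
  proof (rule ccontr)
    have qR: "q \<in> R" "q' \<in> R" using q unfolding Q_def by auto
    assume "q + q' \<notin> Q"
    hence qS: "q + q' \<in> S" using R_add[OF qR] unfolding Q_def by blast
    obtain s where s: "s \<in> R - M" "s * (q' / q) \<in> R" by (rule localizeE[OF le])
    have eq: "s * (q + q') = q * (s + s * (q' / q))" using q(3) by (simp add: algebra_simps)
    have "s * (q + q') \<in> S" by (rule S_mult[OF S_unit[OF s(1)] qS])
    hence "q * (s + s * (q' / q)) \<in> S" by (simp only: eq)
    hence "q \<in> S" using S_factor qR R_add s by blast
    thus False using q unfolding Q_def by blast
  qed
  have "0 \<in> Q" unfolding Q_def S_def by simp
  have Q_add: "q + q' \<in> Q" if q: "q \<in> Q" "q' \<in> Q" for q q'
  proof (cases "q = 0 \<or> q' = 0")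
    case False
    thus ?thesis
      using Q_add_le[of q q'] Q_add_le[of q' q] valuation_primeD(2)[OF V, of q q'] q
      by (auto simp: add.commute)
  qed (use q in auto)
  have subQ: "submodule R Q" unfolding submodule_def using \<open>0 \<in> Q\<close> Q_add Q_absorb by blast
  have "1 \<in> S" using S_unit prime_idealD(3)[OF prime] by blast
  hence Q_prime: "prime_ideal R Q"
    unfolding prime_ideal_def integral_ideal_def using subQ S_mult unfolding Q_def by auto
  have "Q \<noteq> {0}"
  proof
    assume Q0: "Q = {0}"
    obtain m where m: "m \<in> M" "m \<noteq> 0" by (rule nonzero_element[OF t_maximalD(4,5)[OF M]])
    obtain a where a: "a \<in> I" "a \<noteq> 0" by (rule nonzero_element[OF t_idealD(1,2)[OF I(1)]])
    have mR: "m \<in> R" using m(1) t_maximalD(2)[OF M] by blast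
    have "a * m \<in> R" using a(1) I(2) mR R_mult by blast
    moreover have "a * m \<notin> Q" using Q0 a m by simp
    ultimately have "a * m \<in> S" unfolding Q_def by blast
    hence "a / (a * m) \<in> W" using SD(3) IW a(1) by blast
    hence "1 / m \<in> W" using a(2) by simp
    then obtain s where s: "s \<in> R - M" "s * (1 / m) \<in> I" unfolding W_def by (rule localizeE)
    have "s * (1 / m) * m \<in> M"
      using submoduleD(3)[OF t_maximalD(4)[OF M] _ m(1)] s(2) I(2) by blast
    thus False using s(1) m(2) by simp
  qed
  have Q_t: "Q \<in> fractional_t_ideals R"
  proof (rule integral_t_idealI[OF subQ \<open>Q \<noteq> {0}\<close>])
    show "Q \<subseteq> R" by (auto simp: Q_def)
    fix F x assume F: "finite F" "F \<subseteq> Q" "\<not> F \<subseteq> {0}" "x \<in> v_closure R F"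
    have "F \<subseteq> R" using F(2) \<open>Q \<subseteq> R\<close> by blast
    hence xR: "x \<in> R" using v_closure_subset_R F(4) by blast
    have "x \<in> localize R M Q"
      using t_closureI[OF subQ F] t_closure_subset_localize[OF V subQ] by blast
    then obtain s where "s \<in> R - M" "s * x \<in> Q" by (rule localizeE)
    thus "x \<in> Q" using prime_idealD(5)[OF Q_prime _ xR] QM by blast
  qed

  define QQ where "QQ = ideal_mult R Q Q"
  have subQQ: "submodule R QQ" unfolding QQ_def by (rule submodule_ideal_mult)
  have QQ0: "QQ \<noteq> {0}" unfolding QQ_def by (rule ideal_mult_fractional(1)[OF Q_t Q_t])
  have "t_prime_ideal R Q" using Q_prime Q_t by (simp add: t_prime_ideal_def)
  hence "t_closure R QQ \<subset> Q" using discrete by (simp add: strongly_t_discrete_def QQ_def)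
  then obtain q where q: "q \<in> Q" "q \<notin> t_closure R QQ" by blast
  have q0: "q \<noteq> 0" using q(2) t_closure_incl[OF subQQ QQ0] submoduleD(1)[OF subQQ] by auto
  obtain N where N: "t_maximal_ideal R N" "q \<notin> localize R N QQ"
    using mem_t_closureI_local[OF subQQ QQ0, of q] q(2) by blast
  have VN: "valuation_prime N" using PVMD N(1) by (simp add: PVMD_iff)
  have QN: "Q \<subseteq> N"
  proof
    fix s assume "s \<in> Q"
    hence "s * q \<in> QQ" "s \<in> R" using ideal_mult_memI[OF _ q(1)] unfolding QQ_def Q_def by auto
    thus "s \<in> N" using N(2) localizeI[of s N q QQ] by blast
  qed

  \<comment> \<open>That \<open>q\<close> is not in \<open>Q\<^sup>2\<close> locally is known at \<open>N\<close> and needed at \<open>M\<close>. The transfer works because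
    \<open>Q \<subseteq> N\<close> and \<open>R\<^sub>N\<close> is a valuation ring, so that \<open>Q R\<^sub>N\<close> absorbs denominators outside \<open>Q\<close>.\<close>
  have q_not_product: False
    if p: "p \<in> Q" "p' \<in> Q" and t: "t \<in> R - M" and eq: "q * t = p * p'" for p p' t
  proof -
    have tQ: "t \<in> R - Q" using t QM by blast
    have t0: "t \<noteq> 0" by (rule prime_idealD(6)[OF Q_prime tQ])
    have p0: "p' \<noteq> 0" using eq q0 t0 by auto
    have "p' / t \<in> localize R N R"
    proof (rule ccontr)
      assume "p' / t \<notin> localize R N R"
      hence "t / p' \<in> localize R N R" by (rule valuation_primeD(2)[OF VN t0])
      then obtain w where w: "w \<in> R - N" "w * (t / p') \<in> R" by (rule localizeE)
      have "w * t = w * (t / p') * p'" using p0 by simp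
      also have "\<dots> \<in> Q" by (rule Q_absorb[OF w(2) p(2)])
      finally have "w * t \<in> Q" .
      moreover have "w \<in> R - Q" using w(1) QN by blast
      ultimately show False using prime_idealD(4)[OF Q_prime _ tQ] by blast
    qed
    then obtain w where w: "w \<in> R - N" "w * (p' / t) \<in> R" by (rule localizeE)
    define u where "u = w * (p' / t)"
    have "t * u = w * p'" using t0 by (simp add: u_def)
    also have "\<dots> \<in> Q" using w(1) p(2) Q_absorb by blast
    finally have "u \<in> Q" using prime_idealD(5)[OF Q_prime tQ] w(2) by (simp add: u_def)
    hence "p * u \<in> QQ" using ideal_mult_memI[OF p(1)] by (simp add: QQ_def)
    moreover have "w * q = p * u"
    proof -
      have "t * (w * q) = w * (q * t)" by simp
      also have "\<dots> = t * (p * u)" using t0 by (simp add: eq u_def)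
      finally show ?thesis using t0 by simp
    qed
    ultimately have "w * q \<in> QQ" by (simp only:)
    thus False using localizeI[OF w(1)] N(2) by blast
  qed
  \<comment> \<open>In \<open>R\<^sub>Q\<close>, every element of \<open>Q\<close> is a multiple of \<open>q\<close>.\<close>
  have q_generates: "\<exists>r\<in>S. r * (p / q) \<in> R" if p: "p \<in> Q" for p
  proof (cases "p / q \<in> localize R M R")
    case True
    then obtain s where "s \<in> R - M" "s * (p / q) \<in> R" by (rule localizeE)
    thus ?thesis using S_unit by blast
  next
    case False
    hence "q / p \<in> localize R M R" by (rule valuation_primeD(2)[OF V q0])
    then obtain s where s: "s \<in> R - M" "s * (q / p) \<in> R" by (rule localizeE)
    have "0 \<in> localize R M R" using localize_incl[OF prime, of R] by auto
    hence p0: "p \<noteq> 0" using False by auto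
    have "q * s = p * (s * (q / p))" using p0 by simp
    hence "s * (q / p) \<notin> Q" using q_not_product[OF p _ s(1)] by blast
    hence "s * (q / p) \<in> S" using s(2) unfolding Q_def by blast
    moreover have "s * (q / p) * (p / q) \<in> R" using s(1) p0 q0 by simp
    ultimately show ?thesis by blast
  qed

  have "\<exists>a\<in>I. a \<noteq> 0 \<and> (\<forall>x\<in>I. \<forall>y\<in>I. x * y / a \<in> W)"
  proof (rule ccontr)
    assume contra: "\<not> ?thesis"
    \<comment> \<open>This is \<open>W = Q W \<subseteq> q W\<close>: write \<open>a = u y / s\<close> with \<open>u \<in> Q\<close> and divide \<open>u\<close> by \<open>q\<close>.\<close>
    have aq: "a / q \<in> W" if a: "a \<in> I" for a
    proof (cases "a = 0")
      case True
      thus ?thesis using submoduleD(1)[OF subW] by simp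
    next
      case False
      then obtain x y where xy: "x \<in> I" "y \<in> I" "x * y / a \<notin> W" using contra a by blast
      have no: "r * (y / a) \<notin> R" if r: "r \<in> S" for r
      proof
        assume "r * (y / a) \<in> R"
        moreover have "x / r \<in> W" using SD(3)[OF r] IW xy(1) by blast
        ultimately have "(r * (y / a)) * (x / r) \<in> W" by (rule submoduleD(3)[OF subW])
        thus False using xy(3) SD(2)[OF r] by (simp add: mult.commute)
      qed
      have "y / a \<notin> localize R M R" using no S_unit by (auto simp: localize_def)
      hence "a / y \<in> localize R M R" by (rule valuation_primeD(2)[OF V False])
      then obtain s where s: "s \<in> R - M" "s * (a / y) \<in> R" by (rule localizeE)
      define u where "u = s * (a / y)"
      have y0: "y \<noteq> 0" using no[OF \<open>1 \<in> S\<close>] by auto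
      have "u * (y / a) \<in> R" using s(1) y0 False by (simp add: u_def)
      hence "u \<in> Q" using no s(2) unfolding Q_def u_def by blast
      then obtain r where r: "r \<in> S" "r * (u / q) \<in> R" using q_generates by blast
      have "y / r \<in> W" using SD(3)[OF r(1)] IW xy(2) by blast
      hence "(r * (u / q)) * (y / r) / s \<in> W"
        by (intro SD(3)[OF S_unit[OF s(1)]] submoduleD(3)[OF subW r(2)])
      moreover have "(r * (u / q)) * (y / r) / s = a / q"
        using SD(2)[OF r(1)] prime_idealD(6)[OF prime s(1)] y0 by (simp add: u_def)
      ultimately show ?thesis by simp
    qed
    have "w / q \<in> W" if w: "w \<in> W" for w
    proof -
      obtain s where s: "s \<in> R - M" "s * w \<in> I" using w unfolding W_def by (rule localizeE)
      have "s * w / q / s \<in> W" by (rule SD(3)[OF S_unit[OF s(1)] aq[OF s(2)]])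
      thus ?thesis using prime_idealD(6)[OF prime s(1)] by simp
    qed
    hence "q \<in> S" using q(1) q0 unfolding S_def Q_def by blast
    thus False using q(1) by (simp add: Q_def)
  qed
  thus ?thesis using that unfolding W_def by blast
qed

lemma colon_t_ideal:
  assumes A: "finite A" "a \<in> A" "a \<in> R" "a \<noteq> 0"
  shows "colon R A \<in> fractional_t_ideals R"
proof -
  have sub: "submodule R (colon R A)"
    by (auto simp: submodule_def colon_def distrib_right mult.assoc intro: R_add R_mult)
  obtain d where d: "d \<in> R" "d \<noteq> 0" "\<And>x. x \<in> A \<Longrightarrow> d * x \<in> R"
    using common_denominator[OF A(1)] by blast
  hence "d \<in> colon R A" by (simp add: colon_def)
  hence ne: "colon R A \<noteq> {0}" using d by blast
  have "a * x \<in> R" if "x \<in> colon R A" for x using that A by (simp add: colon_def mult.commute)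
  hence "t_closure R (colon R A) \<in> fractional_t_ideals R"
    by (rule t_closure_t_ideal[OF sub ne A(3,4)])
  moreover have "t_closure R (colon R A) \<subseteq> colon R A"
  proof
    fix x assume x: "x \<in> t_closure R (colon R A)"
    have "b * x \<in> R" if "b \<in> A" for b
      using that by (intro t_closure_in_R[OF sub _ x]) (simp add: colon_def mult.commute)
    thus "x \<in> colon R A" by (simp add: colon_def mult.commute)
  qed
  ultimately show ?thesis using t_closure_incl[OF sub ne] by (simp add: subset_antisym)
qed

lemma finite_t_maximal_above:
  assumes "finite_t_character R" "a \<in> R" "a \<noteq> 0"
  shows "finite {M. t_maximal_ideal R M \<and> a \<in> M}"
proof (cases "\<exists>y\<in>R. a * y = 1")
  case True
  then obtain y where y: "y \<in> R" "a * y = 1" by blast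
  have "a \<notin> M" if "t_maximal_ideal R M" for M
    using submoduleD(4)[OF t_maximalD(4)[OF that] y(1), of a] y(2) t_maximalD(3)[OF that] by auto
  hence "{M. t_maximal_ideal R M \<and> a \<in> M} = {}" by blast
  thus ?thesis by (simp only: finite.emptyI)
next
  case False
  thus ?thesis using assms unfolding finite_t_character_def by blast
qed

text \<open>The witness is \<open>J = A\<^sup>-\<^sup>1\<close> for a finite \<open>A \<subseteq> I\<close> that contains, for each maximal t-ideal \<open>M\<close>, some
  \<open>a \<noteq> 0\<close> with \<open>I\<^sup>2 \<subseteq> a I R\<^sub>M\<close>. Then \<open>I\<^sup>2 J \<subseteq> (a J) I R\<^sub>M \<subseteq> I R\<^sub>M\<close>. For the other inclusion, let
  \<open>a\<close> be a local generator of \<open>A\<close>, so that \<open>s / a \<in> J\<close> for some \<open>s\<close> outside \<open>M\<close>; then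
  \<open>s x = (x a) (s / a) \<in> I\<^sup>2 J\<close> for \<open>x \<in> I\<close>.\<close>
lemma integral_t_ideal_regular:
  assumes PVMD: "PVMD R" and char: "finite_t_character R" and discrete: "strongly_t_discrete R"
    and I: "I \<in> fractional_t_ideals R" "I \<subseteq> R"
  shows "\<exists>J\<in>fractional_t_ideals R. t_mult R (t_mult R I I) J = I"
proof -
  note subI = t_idealD(1)[OF I(1)]
  obtain a\<^sub>0 where a0: "a\<^sub>0 \<in> I" "a\<^sub>0 \<noteq> 0" by (rule nonzero_element[OF t_idealD(1,2)[OF I(1)]])
  define T where "T = {M. t_maximal_ideal R M \<and> a\<^sub>0 \<in> M}"
  have "finite T" unfolding T_def using finite_t_maximal_above[OF char] a0 I(2) by blast
  have "\<exists>a. a \<in> I \<and> a \<noteq> 0 \<and> (\<forall>x\<in>I. \<forall>y\<in>I. x * y / a \<in> localize R M I)"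
    if M: "t_maximal_ideal R M" for M
  proof -
    obtain a where "a \<in> I" "a \<noteq> 0" "\<And>x y. x \<in> I \<Longrightarrow> y \<in> I \<Longrightarrow> x * y / a \<in> localize R M I"
      using square_locally_in_multiple[OF PVMD discrete M I] by blast
    thus ?thesis by blast
  qed
  then obtain g where g: "\<And>M. t_maximal_ideal R M \<Longrightarrow>
      g M \<in> I \<and> g M \<noteq> 0 \<and> (\<forall>x\<in>I. \<forall>y\<in>I. x * y / g M \<in> localize R M I)"
    by metis
  define A where "A = insert a\<^sub>0 (g ` T)"
  have A: "finite A" "a\<^sub>0 \<in> A" "A \<subseteq> I" "\<not> A \<subseteq> {0}"
    using \<open>finite T\<close> g a0 unfolding A_def T_def by auto
  define J where "J = colon R A"
  have J: "J \<in> fractional_t_ideals R"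
    unfolding J_def using colon_t_ideal[OF A(1,2)] a0 I(2) by blast
  have II: "t_mult R I I \<in> fractional_t_ideals R" using t_mult_t_ideal I(1) by blast
  have "t_mult R (t_mult R I I) J \<subseteq> I"
  proof (rule t_mult_subset[OF I(1)])
    fix u w assume u: "u \<in> t_mult R I I" and w: "w \<in> J"
    have "w * (x * y) \<in> I" if xy: "x \<in> I" "y \<in> I" for x y
    proof -
      have "w * (x * y) \<in> t_closure R I"
      proof (rule mem_t_closureI_local[OF t_idealD(1,2)[OF I(1)]])
        fix M assume M: "t_maximal_ideal R M"
        note prime = t_maximal_prime[OF M]
        have "\<exists>a\<in>A. a \<noteq> 0 \<and> x * y / a \<in> localize R M I"
        proof (cases "M \<in> T")
          case True
          thus ?thesis using g[OF M] xy unfolding A_def by blast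
        next
          case False
          hence "a\<^sub>0 \<in> R - M" using M a0 I(2) unfolding T_def by blast
          moreover have "a\<^sub>0 * (x * y / a\<^sub>0) \<in> I"
            using a0(2) submoduleD(3)[OF subI _ xy(2), of x] xy(1) I(2) by auto
          ultimately show ?thesis using A(2) a0(2) localizeI by blast
        qed
        then obtain a where a: "a \<in> A" "a \<noteq> 0" "x * y / a \<in> localize R M I" by blast
        have "w * a \<in> R" using w a(1) by (simp add: J_def colon_def)
        hence "w * a * (x * y / a) \<in> localize R M I"
          using submoduleD(3)[OF submodule_localize[OF prime subI] _ a(3)] by blast
        thus "w * (x * y) \<in> localize R M I" using a(2) by simp
      qed
      thus ?thesis by (simp add: t_idealD(3)[OF I(1)])
    qed
    from t_mult_minimal[OF I(1) this u] show "u * w \<in> I" by (simp add: mult.commute)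
  qed
  moreover have "I \<subseteq> t_mult R (t_mult R I I) J"
  proof
    fix x assume x: "x \<in> I"
    show "x \<in> t_mult R (t_mult R I I) J"
      unfolding t_mult_def[of R "t_mult R I I" J]
    proof (rule mem_t_closureI_local[OF submodule_ideal_mult ideal_mult_fractional(1)[OF II J]])
      fix M assume "t_maximal_ideal R M"
      hence V: "valuation_prime M" using PVMD by (simp add: PVMD_iff)
      obtain a s where a: "a \<in> A" "a \<noteq> 0" "s \<in> R - M" "\<And>f. f \<in> A \<Longrightarrow> s * (f / a) \<in> R"
        using finite_local_generator[OF V A(1,4)] by blast
      have "s / a \<in> J" using a(4) by (simp add: J_def colon_def)
      moreover have "x * a \<in> t_mult R I I" using t_mult_memI[OF I(1) I(1) x] a(1) A(3) by blast
      ultimately have "(x * a) * (s / a) \<in> ideal_mult R (t_mult R I I) J"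
        by (intro ideal_mult_memI)
      hence "s * x \<in> ideal_mult R (t_mult R I I) J" using a(2) by (simp add: mult.commute)
      thus "x \<in> localize R M (ideal_mult R (t_mult R I I) J)" by (rule localizeI[OF a(3)])
    qed
  qed
  ultimately show ?thesis using J by blast
qed

text \<open>Regularity passes from the integral t-ideal \<open>d I\<close> to \<open>I\<close>: if \<open>J\<close> is a witness for \<open>d I\<close>, then
  \<open>d J\<close> is one for \<open>I\<close>.\<close>
lemma krull_type_imp_clifford:
  assumes "krull_type_domain R" and discrete: "strongly_t_discrete R"
  shows "clifford_t_regular R"
  unfolding clifford_t_regular_iff
proof
  fix I assume I: "I \<in> fractional_t_ideals R"
  obtain d where d: "d \<in> R" "d \<noteq> 0" "\<forall>x\<in>I. d * x \<in> R" using t_idealD(4)[OF I] by blast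
  have dI: "(*) d ` I \<in> fractional_t_ideals R" by (rule scale_t_ideal[OF I d(2)])
  moreover have "(*) d ` I \<subseteq> R" using d(3) by blast
  ultimately obtain J where J: "J \<in> fractional_t_ideals R"
      "t_mult R (t_mult R ((*) d ` I) ((*) d ` I)) J = (*) d ` I"
    using integral_t_ideal_regular discrete assms(1) unfolding krull_type_domain_def by blast
  have II: "t_mult R I I \<in> fractional_t_ideals R" using t_mult_t_ideal I by blast
  have dJ: "(*) d ` J \<in> fractional_t_ideals R" by (rule scale_t_ideal[OF J(1) d(2)])
  have 1: "t_mult R ((*) d ` I) ((*) d ` I) = (*) d ` (*) d ` t_mult R I I"
    using t_mult_scale[OF I dI d(2)] t_mult_scale[OF I I d(2)] by (simp only: t_mult_commute)
  have 2: "t_mult R ((*) d ` (*) d ` t_mult R I I) J = (*) d ` (*) d ` t_mult R (t_mult R I I) J"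
    by (simp only: t_mult_scale[OF scale_t_ideal[OF II d(2)] J(1) d(2)] t_mult_scale[OF II J(1) d(2)])
  have 3: "t_mult R (t_mult R I I) ((*) d ` J) = (*) d ` t_mult R (t_mult R I I) J"
    using t_mult_scale[OF J(1) II d(2)] by (simp only: t_mult_commute)
  have "(*) d ` I = (*) d ` t_mult R (t_mult R I I) ((*) d ` J)" using J(2) by (simp only: 1 2 3)
  hence "I = t_mult R (t_mult R I I) ((*) d ` J)" using d(2) by (simp add: inj_image_eq_iff inj_on_def)
  thus "\<exists>J\<in>fractional_t_ideals R. t_mult R (t_mult R I I) J = I" using dJ by metis
qed

section \<open>Pseudo-integrally closed Clifford t-regular domains are of Krull type\<close>

text \<open>From \<open>I J \<subseteq> M\<close> one obtains \<open>I\<^sub>t = (I\<^sup>2 J)\<^sub>t \<subseteq> (I M)\<^sub>t\<close>. Whenever \<open>I\<close> can be cancelled, this is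
  impossible for a maximal t-ideal \<open>M\<close>; the lemma serves to show that \<open>I J\<close> lies in no such \<open>M\<close>.\<close>
lemma t_closure_subset_mult_prime:
  assumes I: "submodule R I" "I \<noteq> {0}" and T: "t_closure R I \<in> fractional_t_ideals R"
    and J: "J \<in> fractional_t_ideals R"
    and regular: "t_mult R (t_mult R (t_closure R I) (t_closure R I)) J = t_closure R I"
    and M: "M \<in> fractional_t_ideals R" "M \<subseteq> R"
    and IJM: "\<And>x w. x \<in> I \<Longrightarrow> w \<in> J \<Longrightarrow> x * w \<in> M"
  shows "ideal_mult R I M \<noteq> {0}" "t_closure R I \<subseteq> t_closure R (ideal_mult R I M)"
proof -
  let ?T = "t_closure R I" and ?L = "t_closure R (ideal_mult R I M)"
  have IT: "I \<subseteq> ?T" by (rule t_closure_incl[OF I])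
  obtain x where x: "x \<in> I" "x \<noteq> 0" by (rule nonzero_element[OF I])
  obtain m where m: "m \<in> M" "m \<noteq> 0" by (rule nonzero_element[OF t_idealD(1,2)[OF M(1)]])
  show ne: "ideal_mult R I M \<noteq> {0}"
    using ideal_mult_memI[OF x(1) m(1)] x(2) m(2) by (metis mult_eq_0_iff singletonD)
  obtain d where d: "d \<in> R" "d \<noteq> 0" "\<forall>x\<in>?T. d * x \<in> R" using t_idealD(4)[OF T] by blast
  have "d * (x * y) \<in> R" if "x \<in> I" "y \<in> M" for x y
  proof -
    have "(d * x) * y \<in> R" using that d(3) IT M(2) R_mult by blast
    thus ?thesis by (simp only: mult.assoc)
  qed
  hence "ideal_mult R I M \<subseteq> {z. d * z \<in> R}"
    by (intro ideal_mult_minimal submodule_colon_preimage submodule_R) blast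
  hence L: "?L \<in> fractional_t_ideals R"
    by (intro t_closure_t_ideal[OF submodule_ideal_mult ne d(1,2)]) blast
  have *: "w * (x * y) \<in> ?L" if w: "w \<in> J" and x: "x \<in> ?T" and y: "y \<in> ?T" for w x y
  proof -
    have "(w * x) * y' \<in> ?L" if y': "y' \<in> I" for y'
    proof -
      have "(w * y') * x' \<in> ?L" if x': "x' \<in> I" for x'
        using ideal_mult_memI[OF x' IJM[OF y' w]] t_closure_incl[OF submodule_ideal_mult ne]
        by (auto simp: mult_ac)
      from t_ideal_mult_closed[OF L I(1) this x] show ?thesis by (simp add: mult_ac)
    qed
    from t_ideal_mult_closed[OF L I(1) this y] show ?thesis by (simp add: mult_ac)
  qed
  have "t_mult R (t_mult R ?T ?T) J \<subseteq> ?L"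
  proof (rule t_mult_subset[OF L])
    fix u w assume "u \<in> t_mult R ?T ?T" "w \<in> J"
    from t_mult_minimal[OF L *[OF this(2)] this(1)] show "u * w \<in> ?L" by (simp add: mult.commute)
  qed
  thus "?T \<subseteq> ?L" by (simp add: regular)
qed

lemma regular_mult_closed:
  assumes T: "T \<in> fractional_t_ideals R" and J: "J \<in> fractional_t_ideals R"
    and regular: "t_mult R (t_mult R T T) J = T"
    and "u \<in> T" "w \<in> J" "y \<in> T"
  shows "u * w * y \<in> T"
proof -
  have "(u * y) * w \<in> t_mult R (t_mult R T T) J"
    by (intro t_mult_memI t_mult_t_ideal assms)
  thus ?thesis by (simp add: regular mult_ac)
qed

text \<open>With \<open>I = (a, b)\<close> and \<open>T = I\<^sub>t\<close>, the ideal \<open>T J\<close> consists of multipliers of \<open>T\<close>, so \<open>T J \<subseteq> R\<close>. It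
  remains to find \<open>w \<in> J\<close> with \<open>a w\<close> or \<open>b w\<close> outside \<open>M\<close>. Otherwise \<open>I \<subseteq> (I M)\<^sub>t\<close>; as \<open>I\<close> is
  finitely generated, \<open>I \<subseteq> (I E)\<^sub>v\<close> for a finite \<open>E \<subseteq> M\<close>. Then every \<open>y \<in> E\<^sup>-\<^sup>1\<close> is a multiplier of
  \<open>T\<close>, so \<open>E\<^sup>-\<^sup>1 \<subseteq> R\<close> and \<open>1 \<in> E\<^sub>v \<subseteq> M\<close>, which is absurd.\<close>
lemma clifford_imp_PVMD:
  assumes PIC: "pseudo_integrally_closed R" and clifford: "clifford_t_regular R"
  shows "PVMD R"
  unfolding PVMD_iff valuation_prime_def
proof (intro allI impI conjI)
  fix M assume M: "t_maximal_ideal R M"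
  note MD = t_maximalD[OF M]
  show "prime_ideal R M" by (rule t_maximal_prime[OF M])
  fix x :: 'k assume "x \<noteq> 0"
  obtain a b where ab: "a \<in> R" "b \<in> R" "b \<noteq> 0" "x = a / b" by (rule quotient)
  have a0: "a \<noteq> 0" using \<open>x \<noteq> 0\<close> ab by auto
  define I where "I = submodule R hull {a, b}"
  define T where "T = t_closure R I"
  have subI: "submodule R I" unfolding I_def by (rule submodule_hull)
  have abI: "a \<in> I" "b \<in> I" unfolding I_def by (auto intro: hull_inc)
  have I0: "I \<noteq> {0}" using abI a0 by auto
  have IR: "I \<subseteq> R" unfolding I_def using ab by (intro hull_minimal submodule_R) auto
  have I_minimal: "I \<subseteq> {z. c * z \<in> L}" if "submodule R L" "c * a \<in> L" "c * b \<in> L" for c L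
    unfolding I_def using that by (intro hull_minimal submodule_colon_preimage) auto
  have IT: "I \<subseteq> T" unfolding T_def by (rule t_closure_incl[OF subI I0])
  have T: "T \<in> fractional_t_ideals R"
    unfolding T_def using IR by (intro t_closure_t_ideal[OF subI I0, of 1]) auto
  obtain J where J: "J \<in> fractional_t_ideals R" "t_mult R (t_mult R T T) J = T"
    using clifford T unfolding clifford_t_regular_iff by blast
  have colon_T: "c \<in> R" if "\<And>z. z \<in> T \<Longrightarrow> c * z \<in> T" for c
  proof -
    have "finitely_generated R I"
      unfolding finitely_generated_def I_def by (intro exI[of _ "{a, b}"]) simp
    moreover have "integral_ideal R I" using subI IR by (simp add: integral_ideal_def)
    moreover have "c \<in> colon (t_closure R I) (t_closure R I)"
      using that by (simp add: colon_def T_def)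
    ultimately have "c \<in> pseudo_integral_closure R"
      unfolding pseudo_integral_closure_def using I0
      by (intro UnionI[of "colon (t_closure R I) (t_closure R I)"]) auto
    thus ?thesis using PIC by (simp add: pseudo_integrally_closed_def)
  qed
  have TJ: "u * w \<in> R" if "u \<in> T" "w \<in> J" for u w
    by (rule colon_T) (rule regular_mult_closed[OF T J that])
  have TJ': "a * w \<in> R" "b * w \<in> R" if "w \<in> J" for w
    using TJ that abI IT by blast+
  have "\<exists>w\<in>J. a * w \<notin> M \<or> b * w \<notin> M"
  proof (rule ccontr)
    assume "\<not> ?thesis"
    hence JM: "w * a \<in> M" "w * b \<in> M" if "w \<in> J" for w using that by (auto simp: mult.commute)
    have IJM: "z * w \<in> M" if "z \<in> I" "w \<in> J" for z w
      using I_minimal[OF MD(4) JM[OF that(2)]] that(1) by (auto simp: mult.commute)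
    note sub_mult = t_closure_subset_mult_prime[OF subI I0 T[unfolded T_def] J(1)
        J(2)[unfolded T_def] MD(1,2) IJM]
    have "finite {a, b}" "{a, b} \<subseteq> t_closure R (ideal_mult R I M)"
      using sub_mult(2) abI IT unfolding T_def by auto
    from t_closure_finite[OF submodule_ideal_mult sub_mult(1) this] obtain G where
      G: "finite G" "G \<subseteq> ideal_mult R I M" "\<not> G \<subseteq> {0}" "{a, b} \<subseteq> v_closure R G" .
    define L where "L = {z. \<exists>m\<in>M. \<exists>m'\<in>M. z = m * a + m' * b}"
    have subL: "submodule R L"
      unfolding submodule_def
    proof (intro conjI ballI)
      show "0 \<in> L" using submoduleD(1)[OF MD(4)] unfolding L_def by force
    next
      fix y z assume "y \<in> L" "z \<in> L"
      then obtain m m' n n' where mn: "m \<in> M" "m' \<in> M" "n \<in> M" "n' \<in> M"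
        "y = m * a + m' * b" "z = n * a + n' * b" unfolding L_def by blast
      have "y + z = (m + n) * a + (m' + n') * b" by (simp add: mn algebra_simps)
      thus "y + z \<in> L" using submoduleD(2)[OF MD(4)] mn(1-4) unfolding L_def by blast
    next
      fix r z assume r: "r \<in> R" and "z \<in> L"
      then obtain m m' where mn: "m \<in> M" "m' \<in> M" "z = m * a + m' * b" unfolding L_def by blast
      have "r * z = (r * m) * a + (r * m') * b" by (simp add: mn algebra_simps)
      thus "r * z \<in> L" using submoduleD(3)[OF MD(4) r] mn(1,2) unfolding L_def by blast
    qed
    have "ideal_mult R I M \<subseteq> L"
    proof (rule ideal_mult_minimal[OF subL])
      fix z m assume z: "z \<in> I" and m: "m \<in> M"
      have "m * a = m * a + 0 * b" "m * b = 0 * a + m * b" by auto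
      hence "m * a \<in> L" "m * b \<in> L" using m submoduleD(1)[OF MD(4)] unfolding L_def by blast+
      hence "m * z \<in> L" using I_minimal[OF subL] z by blast
      thus "z * m \<in> L" by (simp only: mult.commute)
    qed
    hence "\<forall>g\<in>G. \<exists>m m'. m \<in> M \<and> m' \<in> M \<and> g = m * a + m' * b" using G(2) unfolding L_def by blast
    then obtain h h' where h: "\<And>g. g \<in> G \<Longrightarrow> h g \<in> M \<and> h' g \<in> M \<and> g = h g * a + h' g * b"
      by metis
    define E where "E = h ` G \<union> h' ` G"
    have E: "finite E" "E \<subseteq> M" using G(1) h unfolding E_def by auto
    have "\<not> E \<subseteq> {0}"
    proof
      assume "E \<subseteq> {0}"
      hence "g = 0" if "g \<in> G" for g
      proof -
        have "h g = 0" "h' g = 0" using that \<open>E \<subseteq> {0}\<close> unfolding E_def by auto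
        thus ?thesis using h[OF that] by simp
      qed
      thus False using G(3) by blast
    qed
    have "1 \<in> v_closure R E"
      unfolding v_closure_iff
    proof (intro allI impI)
      fix y assume y: "\<forall>e\<in>E. y * e \<in> R"
      have "y * g \<in> v_closure R {a, b}" if "g \<in> G" for g
      proof -
        note v = submodule_v_closure[of "{a, b}"]
        have "y * h g \<in> R" "y * h' g \<in> R" using y that unfolding E_def by auto
        hence "(y * h g) * a + (y * h' g) * b \<in> v_closure R {a, b}"
          using submoduleD(2,3)[OF v] v_closure_incl[of "{a, b}"] by blast
        moreover have "y * g = (y * h g) * a + (y * h' g) * b"
          using h[OF that] by (metis distrib_left mult.assoc)
        ultimately show ?thesis by (simp only:)
      qed
      hence "y * a \<in> v_closure R {a, b}" "y * b \<in> v_closure R {a, b}"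
        using v_closure_mult[of G y "{a, b}"] G(4) by blast+
      moreover have "v_closure R {a, b} \<subseteq> T"
        unfolding T_def using abI a0 by (intro subsetI t_closureI[OF subI, of "{a, b}"]) auto
      ultimately have "I \<subseteq> {z. y * z \<in> T}" by (intro I_minimal t_idealD(1)[OF T]) blast+
      hence "y * z \<in> T" if "z \<in> T" for z
        using t_ideal_mult_closed[OF T subI, of y z] that unfolding T_def by blast
      thus "1 * y \<in> R" using colon_T by simp
    qed
    hence "1 \<in> t_closure R M" by (rule t_closureI[OF MD(4) E \<open>\<not> E \<subseteq> {0}\<close>])
    thus False using MD(3) by (simp add: t_idealD(3)[OF MD(1)])
  qed
  then obtain w where w: "w \<in> J" "a * w \<notin> M \<or> b * w \<notin> M" by blast
  show "x \<in> localize R M R \<or> inverse x \<in> localize R M R"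
    using w(2)
  proof
    assume "a * w \<notin> M"
    moreover have "(a * w) * inverse x = b * w" using a0 ab(3,4) by simp
    ultimately have "(a * w) * inverse x \<in> R" "a * w \<in> R - M"
      using TJ'[OF w(1)] by (simp_all only: Diff_iff simp_thms)
    thus ?thesis using localizeI by blast
  next
    assume "b * w \<notin> M"
    moreover have "(b * w) * x = a * w" using ab(3,4) by simp
    ultimately have "(b * w) * x \<in> R" "b * w \<in> R - M"
      using TJ'[OF w(1)] by (simp_all only: Diff_iff simp_thms)
    thus ?thesis using localizeI by blast
  qed
qed

text \<open>Multipliers of \<open>I\<^sub>t\<close> lie in every \<open>R\<^sub>M\<close>, because \<open>I\<^sub>t R\<^sub>M = a R\<^sub>M\<close>; so \<open>I J \<subseteq> R\<close>. If \<open>I J\<close> were contained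
  in \<open>M\<close>, then \<open>a \<in> I\<^sub>t \<subseteq> I M R\<^sub>M = a M R\<^sub>M\<close>, which is absurd.\<close>
lemma locally_principal_imp_t_invertible:
  assumes PVMD: "PVMD R" and clifford: "clifford_t_regular R"
    and I: "submodule R I" "I \<noteq> {0}" and d: "d \<in> R" "d \<noteq> 0" "\<And>x. x \<in> I \<Longrightarrow> d * x \<in> R"
    and loc: "\<And>M. t_maximal_ideal R M \<Longrightarrow> \<exists>a\<in>I. a \<noteq> 0 \<and> (\<forall>y\<in>I. y / a \<in> localize R M R)"
  shows "\<exists>J\<in>fractional_t_ideals R. (\<forall>x\<in>I. \<forall>w\<in>J. x * w \<in> R) \<and>
    (\<forall>M. t_maximal_ideal R M \<longrightarrow> (\<exists>x\<in>I. \<exists>w\<in>J. x * w \<in> R - M))"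
proof -
  define T where "T = t_closure R I"
  have T: "T \<in> fractional_t_ideals R" unfolding T_def by (rule t_closure_t_ideal[OF I d])
  have IT: "I \<subseteq> T" unfolding T_def by (rule t_closure_incl[OF I])
  obtain J where J: "J \<in> fractional_t_ideals R" "t_mult R (t_mult R T T) J = T"
    using clifford T unfolding clifford_t_regular_iff by blast
  have IJ: "x * w \<in> R" if x: "x \<in> I" and w: "w \<in> J" for x w
  proof (rule mem_R_local)
    fix M assume M: "t_maximal_ideal R M"
    hence V: "valuation_prime M" using PVMD by (simp add: PVMD_iff)
    note prime = valuation_primeD(1)[OF V]
    obtain a where a: "a \<in> I" "a \<noteq> 0" "\<forall>y\<in>I. y / a \<in> localize R M R" using loc[OF M] by blast
    have "x * w * a \<in> T" using regular_mult_closed[OF T J _ w] x a(1) IT by blast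
    hence "x * w * a \<in> localize R M I"
      using t_closure_subset_localize[OF V I(1)] unfolding T_def by blast
    then obtain s where s: "s \<in> R - M" "s * (x * w * a) \<in> I" by (rule localizeE)
    have "s * (x * w * a) / a \<in> localize R M R" using a(3) s(2) by blast
    then obtain t where t: "t \<in> R - M" "t * (s * (x * w * a) / a) \<in> R" by (rule localizeE)
    have "(t * s) * (x * w) \<in> R" using t(2) a(2) by (simp add: mult.assoc)
    thus "x * w \<in> localize R M R" by (rule localizeI[OF prime_idealD(4)[OF prime t(1) s(1)]])
  qed
  have "\<exists>x\<in>I. \<exists>w\<in>J. x * w \<in> R - M" if M: "t_maximal_ideal R M" for M
  proof (rule ccontr)
    assume "\<not> ?thesis"
    hence IJM: "x * w \<in> M" if "x \<in> I" "w \<in> J" for x w using IJ that by blast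
    note MD = t_maximalD[OF M]
    have V: "valuation_prime M" using M PVMD by (simp add: PVMD_iff)
    note prime = valuation_primeD(1)[OF V]
    obtain a where a: "a \<in> I" "a \<noteq> 0" "\<forall>y\<in>I. y / a \<in> localize R M R" using loc[OF M] by blast
    have "a \<in> t_closure R (ideal_mult R I M)"
      using t_closure_subset_mult_prime(2)[OF I T[unfolded T_def] J(1) J(2)[unfolded T_def]
          MD(1,2) IJM] a(1) IT unfolding T_def by blast
    hence "a \<in> localize R M (ideal_mult R I M)"
      using t_closure_subset_localize[OF V submodule_ideal_mult] by blast
    then obtain s where s: "s \<in> R - M" "s * a \<in> ideal_mult R I M" by (rule localizeE)
    have "ideal_mult R I M \<subseteq> {z. (1 / a) * z \<in> localize R M M}"
    proof (intro ideal_mult_minimal submodule_colon_preimage submodule_localize prime MD(4))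
      fix y m assume y: "y \<in> I" and m: "m \<in> M"
      have "(y / a) * m \<in> localize R M M"
        using localize_mult[OF prime MD(4)] a(3) y m localize_incl[OF prime, of M] by blast
      thus "y * m \<in> {z. (1 / a) * z \<in> localize R M M}" by simp
    qed
    hence "s \<in> localize R M M" using s(2) a(2) by auto
    then obtain t where "t \<in> R - M" "t * s \<in> M" by (rule localizeE)
    thus False using prime_idealD(4)[OF prime _ s(1)] by blast
  qed
  thus ?thesis using J(1) IJ by blast
qed

text \<open>An element of \<open>M\<close> outside \<open>(M\<^sup>2)\<^sub>t\<close> can avoid \<open>M\<^sup>2 R\<^sub>N\<close> only at \<open>N = M\<close>, since \<open>M\<^sup>2 R\<^sub>N = R\<^sub>N\<close> for
  all other \<open>N\<close>. In the valuation ring \<open>R\<^sub>M\<close> it then generates the maximal ideal.\<close>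
lemma t_maximal_locally_principal:
  assumes PVMD: "PVMD R" and discrete: "strongly_t_discrete R"
    and M: "t_maximal_ideal R M" and N: "t_maximal_ideal R N"
  shows "\<exists>a\<in>M. a \<noteq> 0 \<and> (\<forall>y\<in>M. y / a \<in> localize R N R)"
proof (cases "M = N")
  case False
  then obtain a where a: "a \<in> M" "a \<in> R - N" by (rule t_maximal_not_subset[OF M N])
  have a0: "a \<noteq> 0" by (rule prime_idealD(6)[OF t_maximal_prime[OF N] a(2)])
  have "y / a \<in> localize R N R" if "y \<in> M" for y
    using a0 that t_maximalD(2)[OF M] by (intro localizeI[OF a(2)]) auto
  thus ?thesis using a(1) a0 by blast
next
  case True
  note MD = t_maximalD[OF M]
  have V: "valuation_prime M" using M PVMD by (simp add: PVMD_iff)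
  note prime = valuation_primeD(1)[OF V]
  define MM where "MM = ideal_mult R M M"
  have subMM: "submodule R MM" unfolding MM_def by (rule submodule_ideal_mult)
  have MM0: "MM \<noteq> {0}" unfolding MM_def by (rule ideal_mult_fractional(1)[OF MD(1) MD(1)])
  have "t_prime_ideal R M" using prime MD(1) by (simp add: t_prime_ideal_def)
  hence "t_closure R MM \<subset> M" using discrete by (simp add: strongly_t_discrete_def MM_def)
  then obtain p where p: "p \<in> M" "p \<notin> t_closure R MM" by blast
  have p0: "p \<noteq> 0" using p(2) t_closure_incl[OF subMM MM0] submoduleD(1)[OF subMM] by auto
  obtain N' where N': "t_maximal_ideal R N'" "p \<notin> localize R N' MM"
    using mem_t_closureI_local[OF subMM MM0, of p] p(2) by blast
  have "M = N'"
  proof (rule ccontr)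
    assume "M \<noteq> N'"
    then obtain a where a: "a \<in> M" "a \<in> R - N'" by (rule t_maximal_not_subset[OF M N'(1)])
    have "a * p \<in> MM" unfolding MM_def by (rule ideal_mult_memI[OF a(1) p(1)])
    thus False using localizeI[OF a(2)] N'(2) by blast
  qed
  have "y / p \<in> localize R M R" if y: "y \<in> M" for y
  proof (rule ccontr)
    assume not: "y / p \<notin> localize R M R"
    hence "p / y \<in> localize R M R" by (rule valuation_primeD(2)[OF V p0])
    then obtain s where s: "s \<in> R - M" "s * (p / y) \<in> R" by (rule localizeE)
    have "0 \<in> localize R M R" using localize_incl[OF prime, of R] by auto
    hence y0: "y \<noteq> 0" using not by auto
    show False
    proof (cases "s * (p / y) \<in> M")
      case True
      have "s * (p / y) * y \<in> MM" unfolding MM_def by (rule ideal_mult_memI[OF True y])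
      hence "s * p \<in> MM" using y0 by simp
      thus False using localizeI[OF s(1)] N'(2) \<open>M = N'\<close> by blast
    next
      case False
      have "s * (p / y) * (y / p) \<in> R" using s(1) y0 p0 by simp
      moreover have "s * (p / y) \<in> R - M" using False s(2) by blast
      ultimately show False using localizeI not by blast
    qed
  qed
  thus ?thesis using p(1) p0 \<open>M = N\<close> by blast
qed

lemma t_maximal_t_invertible:
  assumes PVMD: "PVMD R" and clifford: "clifford_t_regular R" and discrete: "strongly_t_discrete R"
    and M: "t_maximal_ideal R M"
  obtains m w where "m \<in> M" "w \<in> colon R M" "m * w \<in> R - M"
proof -
  note MD = t_maximalD[OF M]
  have MR: "1 * x \<in> R" if "x \<in> M" for x using that MD(2) by auto
  obtain J where J: "\<And>x w. x \<in> M \<Longrightarrow> w \<in> J \<Longrightarrow> x * w \<in> R"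
      "\<And>N. t_maximal_ideal R N \<Longrightarrow> \<exists>x\<in>M. \<exists>w\<in>J. x * w \<in> R - N"
    using locally_principal_imp_t_invertible[OF PVMD clifford MD(4,5) R_one one_neq_zero MR
        t_maximal_locally_principal[OF PVMD discrete M]] by blast
  obtain m w where mw: "m \<in> M" "w \<in> J" "m * w \<in> R - M" using J(2)[OF M] by blast
  have "w \<in> colon R M" using J(1) mw(2) by (simp add: colon_def mult.commute)
  thus ?thesis using that mw by blast
qed

text \<open>The set \<open>B\<close> makes the finite set of exceptions uniform over a family of multipliers.\<close>
lemma submodule_cofinitely_local:
  "submodule R {z. finite {N. t_maximal_ideal R N \<and> (\<exists>b\<in>B. b * z \<notin> localize R N R)}}"
  (is "submodule R {z. finite (?bad z)}")
proof -
  note sub = submodule_localize[OF t_maximal_prime submodule_R]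
  have "?bad 0 = {}" using submoduleD(1)[OF sub] by auto
  hence 0: "finite (?bad 0)" by (simp only: finite.emptyI)
  have "?bad (y + z) \<subseteq> ?bad y \<union> ?bad z" for y z
    unfolding distrib_left using submoduleD(2)[OF sub] by blast
  hence add: "finite (?bad y) \<Longrightarrow> finite (?bad z) \<Longrightarrow> finite (?bad (y + z))" for y z
    by (meson finite_UnI finite_subset)
  have bad_mult: "?bad (r * z) \<subseteq> ?bad z" if "r \<in> R" for r z
    unfolding mult.left_commute[of _ r] using submoduleD(3)[OF sub that] by blast
  have mult: "finite (?bad (r * z))" if "r \<in> R" "finite (?bad z)" for r z
    by (rule finite_subset[OF bad_mult[OF that(1)] that(2)])
  show ?thesis unfolding submodule_def
    by (intro conjI ballI; unfold mem_Collect_eq)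
      (rule 0, (rule add; assumption), (rule mult; assumption))
qed

text \<open>The ideal \<open>I\<close> below satisfies \<open>I R\<^sub>N = x N\<^sup>-\<^sup>1 R\<^sub>N\<close> if \<open>x \<in> N\<close>, and \<open>I R\<^sub>N = x R\<^sub>N\<close> otherwise. Both are
  principal, so \<open>1 \<in> D\<^sub>v\<close> for some finite \<open>D \<subseteq> I J\<close> with \<open>I J \<subseteq> R\<close>. Each \<open>d \<in> D\<close> satisfies
  \<open>d I \<subseteq> x R\<^sub>N\<close> for all but finitely many \<open>N\<close>. However, some \<open>d \<in> D\<close> is a unit of \<open>R\<^sub>N\<close>, and for
  \<open>x \<in> N\<close> the inclusion \<open>I \<subseteq> x R\<^sub>N\<close> would give \<open>N\<^sup>-\<^sup>1 \<subseteq> R\<^sub>N\<close>, contradicting the t-invertibility of \<open>N\<close>.\<close>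
lemma clifford_imp_finite_t_character:
  assumes PVMD: "PVMD R" and clifford: "clifford_t_regular R" and discrete: "strongly_t_discrete R"
  shows "finite_t_character R"
  unfolding finite_t_character_def
proof (intro ballI impI)
  fix x assume xR: "x \<in> R" and "x \<noteq> 0 \<and> \<not> (\<exists>y\<in>R. x * y = 1)"
  hence x0: "x \<noteq> 0" by blast
  define \<M> where "\<M> = {M. t_maximal_ideal R M \<and> x \<in> M}"
  define I where "I = submodule R hull (insert x {x * w | w M. M \<in> \<M> \<and> w \<in> colon R M})"
  have subI: "submodule R I" unfolding I_def by (rule submodule_hull)
  have xI: "x \<in> I" unfolding I_def by (rule hull_inc) blast
  have xwI: "x * w \<in> I" if "M \<in> \<M>" "w \<in> colon R M" for M w
    unfolding I_def using that by (intro hull_inc) blast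
  have I_minimal: "I \<subseteq> L"
    if "submodule R L" "x \<in> L" "\<And>M w. M \<in> \<M> \<Longrightarrow> w \<in> colon R M \<Longrightarrow> x * w \<in> L" for L
    unfolding I_def using that by (intro hull_minimal) auto
  have IR: "I \<subseteq> R"
    using xR by (intro I_minimal submodule_R) (auto simp: \<M>_def colon_def mult.commute)
  have I0: "I \<noteq> {0}" using xI x0 by blast
  have inverse_local: "w \<in> localize R N R"
    if MN: "t_maximal_ideal R M" "t_maximal_ideal R N" "M \<noteq> N" and w: "w \<in> colon R M" for M N w
  proof -
    obtain m where m: "m \<in> M" "m \<in> R - N" by (rule t_maximal_not_subset[OF MN])
    have "m * w \<in> R" using w m(1) by (simp add: colon_def mult.commute)
    thus ?thesis by (rule localizeI[OF m(2)])
  qed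
  have loc: "\<exists>a\<in>I. a \<noteq> 0 \<and> (\<forall>y\<in>I. y / a \<in> localize R N R)" if N: "t_maximal_ideal R N" for N
  proof -
    note prime = t_maximal_prime[OF N]
    note subV = submodule_localize[OF prime submodule_R]
    have one: "1 \<in> localize R N R" using localize_incl[OF prime, of R] by auto
    show ?thesis
    proof (cases "N \<in> \<M>")
      case False
      have "I \<subseteq> {y. (1 / x) * y \<in> localize R N R}"
      proof (intro I_minimal submodule_colon_preimage subV)
        fix M w assume "M \<in> \<M>" "w \<in> colon R M"
        thus "x * w \<in> {y. (1 / x) * y \<in> localize R N R}"
          using inverse_local[OF _ N] False x0 by (auto simp: \<M>_def)
      qed (use one x0 in simp)
      thus ?thesis using xI x0 by (intro bexI[of _ x]) auto
    next
      case True
      obtain n w\<^sub>0 where n: "n \<in> N" "w\<^sub>0 \<in> colon R N" "n * w\<^sub>0 \<in> R - N"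
        by (rule t_maximal_t_invertible[OF PVMD clifford discrete N])
      have w0: "w\<^sub>0 \<noteq> 0" using prime_idealD(6)[OF prime n(3)] by auto
      have nR: "n \<in> R" using n(1) t_maximalD(2)[OF N] by blast
      have inv: "w / w\<^sub>0 \<in> localize R N R" if wn: "w * n \<in> localize R N R" for w
      proof -
        obtain s where s: "s \<in> R - N" "s * (w * n) \<in> R" by (rule localizeE[OF wn])
        have "(s * (n * w\<^sub>0)) * (w / w\<^sub>0) = s * (w * n)" using w0 by simp
        hence "(s * (n * w\<^sub>0)) * (w / w\<^sub>0) \<in> R" using s(2) by (simp only:)
        thus ?thesis by (rule localizeI[OF prime_idealD(4)[OF prime s(1) n(3)]])
      qed
      have "I \<subseteq> {y. (1 / (x * w\<^sub>0)) * y \<in> localize R N R}"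
      proof (intro I_minimal submodule_colon_preimage subV)
        have "1 * n \<in> localize R N R" using nR localize_incl[OF prime, of R] by auto
        thus "x \<in> {y. (1 / (x * w\<^sub>0)) * y \<in> localize R N R}" using inv[of 1] x0 by simp
      next
        fix M w assume M: "M \<in> \<M>" and w: "w \<in> colon R M"
        have "w * n \<in> localize R N R"
        proof (cases "M = N")
          case True
          hence "w * n \<in> R" using w n(1) by (simp add: colon_def)
          thus ?thesis using localize_incl[OF prime] by blast
        next
          case False
          hence "w \<in> localize R N R" using inverse_local[OF _ N _ w] M by (simp add: \<M>_def)
          hence "n * w \<in> localize R N R" by (rule submoduleD(3)[OF subV nR])
          thus ?thesis by (simp add: mult.commute)
        qed
        from inv[OF this] show "x * w \<in> {y. (1 / (x * w\<^sub>0)) * y \<in> localize R N R}"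
          using x0 by simp
      qed
      moreover have "x * w\<^sub>0 \<in> I" by (rule xwI[OF True n(2)])
      ultimately show ?thesis using x0 w0 by (intro bexI[of _ "x * w\<^sub>0"]) auto
    qed
  qed
  have IR': "1 * y \<in> R" if "y \<in> I" for y using that IR by auto
  obtain J where J: "J \<in> fractional_t_ideals R" "\<And>y w. y \<in> I \<Longrightarrow> w \<in> J \<Longrightarrow> y * w \<in> R"
      "\<And>M. t_maximal_ideal R M \<Longrightarrow> \<exists>y\<in>I. \<exists>w\<in>J. y * w \<in> R - M"
    using locally_principal_imp_t_invertible[OF PVMD clifford subI I0 R_one one_neq_zero IR' loc]
    by blast
  define E where "E = ideal_mult R I J"
  have subE: "submodule R E" unfolding E_def by (rule submodule_ideal_mult)
  have ER: "E \<subseteq> R" unfolding E_def by (intro ideal_mult_minimal submodule_R J(2))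
  have E0: "E \<noteq> {0}"
  proof -
    obtain w where w: "w \<in> J" "w \<noteq> 0" by (rule nonzero_element[OF t_idealD(1,2)[OF J(1)]])
    have "x * w \<in> E" unfolding E_def by (rule ideal_mult_memI[OF xI w(1)])
    thus ?thesis using x0 w(2) by auto
  qed
  have "1 \<in> t_closure R E"
  proof (rule ccontr)
    assume "1 \<notin> t_closure R E"
    then obtain M where M: "t_maximal_ideal R M" "E \<subseteq> M" by (rule exists_t_maximal[OF subE E0 ER])
    thus False using J(3)[OF M(1)] ideal_mult_memI[of _ I _ J] unfolding E_def by blast
  qed
  then obtain D where D: "finite D" "D \<subseteq> E" "\<not> D \<subseteq> {0}" "1 \<in> v_closure R D"
    unfolding t_closure_iff[OF subE] by blast

  \<comment> \<open>An element of \<open>I\<close> lies in \<open>x\<close> times the localization at all but finitely many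
    maximal t-ideals; hence so does \<open>d I\<close> for \<open>d\<close> in \<open>E\<close>, with exceptions that depend on \<open>d\<close> only.\<close>
  define bad where "bad d = {N. t_maximal_ideal R N \<and> (\<exists>y\<in>I. y / x * d \<notin> localize R N R)}" for d
  have I_cofin: "finite {N. t_maximal_ideal R N \<and> z / x \<notin> localize R N R}" if "z \<in> I" for z
  proof -
    have "I \<subseteq> {z. finite {N. t_maximal_ideal R N \<and> (\<exists>b\<in>{1 / x}. b * z \<notin> localize R N R)}}"
    proof (rule I_minimal[OF submodule_cofinitely_local]; unfold mem_Collect_eq)
      have "1 \<in> localize R N R" if "t_maximal_ideal R N" for N
        using localize_incl[OF t_maximal_prime[OF that], of R] by auto
      hence "{N. t_maximal_ideal R N \<and> (\<exists>b\<in>{1 / x}. b * x \<notin> localize R N R)} = {}"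
        using x0 by auto
      thus "finite {N. t_maximal_ideal R N \<and> (\<exists>b\<in>{1 / x}. b * x \<notin> localize R N R)}"
        by (simp only: finite.emptyI)
      fix M w assume "M \<in> \<M>" "w \<in> colon R M"
      hence "{N. t_maximal_ideal R N \<and> (\<exists>b\<in>{1 / x}. b * (x * w) \<notin> localize R N R)} \<subseteq> {M}"
        using inverse_local[of M] x0 by (auto simp: \<M>_def)
      thus "finite {N. t_maximal_ideal R N \<and> (\<exists>b\<in>{1 / x}. b * (x * w) \<notin> localize R N R)}"
        by (rule finite_subset) simp
    qed
    thus ?thesis using that by auto
  qed
  have "E \<subseteq> {d. finite {N. t_maximal_ideal R N \<and> (\<exists>b\<in>(\<lambda>y. y / x) ` I. b * d \<notin> localize R N R)}}"
    unfolding E_def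
  proof (rule ideal_mult_minimal[OF submodule_cofinitely_local]; unfold mem_Collect_eq)
    fix z w assume z: "z \<in> I" and w: "w \<in> J"
    have "y / x * (z * w) \<in> localize R N R"
      if N: "t_maximal_ideal R N" "z / x \<in> localize R N R" and y: "y \<in> I" for N y
      using submoduleD(3)[OF submodule_localize[OF t_maximal_prime[OF N(1)] submodule_R]
          J(2)[OF y w] N(2)] by (simp add: mult_ac)
    thus "finite {N. t_maximal_ideal R N \<and> (\<exists>b\<in>(\<lambda>y. y / x) ` I. b * (z * w) \<notin> localize R N R)}"
      by (intro finite_subset[OF _ I_cofin[OF z]]) blast
  qed
  hence "finite (\<Union>d\<in>D. bad d)" using D(1,2) unfolding bad_def by auto
  moreover have "\<M> \<subseteq> (\<Union>d\<in>D. bad d)"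
  proof
    fix N assume N\<M>: "N \<in> \<M>"
    hence N: "t_maximal_ideal R N" by (simp add: \<M>_def)
    note prime = t_maximal_prime[OF N] and ND = t_maximalD[OF N]
    have "\<not> D \<subseteq> N"
      using t_closureI[OF ND(4) D(1) _ D(3,4)] ND(3) by (auto simp: t_idealD(3)[OF ND(1)])
    then obtain d where d: "d \<in> D" "d \<in> R - N" using D(2) ER by blast
    obtain n w where n: "n \<in> N" "w \<in> colon R N" "n * w \<in> R - N"
      by (rule t_maximal_t_invertible[OF PVMD clifford discrete N])
    have "w * d \<notin> localize R N R"
    proof
      assume "w * d \<in> localize R N R"
      then obtain s where s: "s \<in> R - N" "s * (w * d) \<in> R" by (rule localizeE)
      have "(s * d) * (n * w) = s * (w * d) * n" by (simp add: mult_ac)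
      also have "\<dots> \<in> N" by (rule submoduleD(3)[OF ND(4) s(2) n(1)])
      finally show False
        using prime_idealD(4)[OF prime prime_idealD(4)[OF prime s(1) d(2)] n(3)] by blast
    qed
    moreover have "x * w / x * d = w * d" using x0 by simp
    ultimately have "x * w / x * d \<notin> localize R N R"
      by (simp only: not_False_eq_True)
    hence "N \<in> bad d" using N xwI[OF N\<M> n(2)] unfolding bad_def by blast
    thus "N \<in> (\<Union>d\<in>D. bad d)" using d(1) by blast
  qed
  ultimately show "finite {M. t_maximal_ideal R M \<and> x \<in> M}"
    unfolding \<M>_def by (rule rev_finite_subset)
qed

end

theorem corollary3p12:
  fixes R :: "'k::field set"
  assumes "domain_with_quotient_field R"
    and "strongly_t_discrete R"
  shows "pseudo_integrally_closed R \<and> clifford_t_regular R \<longleftrightarrow> krull_type_domain R"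
proof -
  interpret domain_in_field R using assms(1) by unfold_locales
  show ?thesis
  proof
    assume "pseudo_integrally_closed R \<and> clifford_t_regular R"
    thus "krull_type_domain R"
      using clifford_imp_PVMD clifford_imp_finite_t_character[OF _ _ assms(2)]
      by (simp add: krull_type_domain_def)
  next
    assume krull: "krull_type_domain R"
    hence "PVMD R" by (simp add: krull_type_domain_def)
    thus "pseudo_integrally_closed R \<and> clifford_t_regular R"
      using PVMD_imp_pseudo_integrally_closed krull_type_imp_clifford[OF krull assms(2)] by blast
  qed
qed

end
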